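(* Let $f:\mathbb{R}^d\to\mathbb{R}$ be a convex function which is continuous, has at least one minimizer, and satisfies $\int_{\mathbb{R}^d} \exp(-f(y)/\delta)\,dy<+\infty$, and denote $X^{\star}:=\operatorname{argmin} f$. Let $(x^k)_{k\in\mathbb{N}}$ be generated by $x^{k+1}=\operatorname{zprox}^\delta_{\lambda,f}(x^k)$. Then \begin{enumerate} \item[(i)] for every $k\ge 1$, \[ f(x^{k})-\min_y f(y)\leq \|\nabla f^{\lambda,\delta}(x^{k-1})\|\operatorname{dist}(x^{k},X^\star)+ d \delta; \] \item[(ii)] if $f$ is $L$-smooth then \(\|\nabla f(x^k)\| \leq (1+\lambda L) \|\nabla f^{\lambda, \delta}(x^k)\|+ L \sqrt{d \lambda \delta}\) and, in addition to the bound in (i), it also holds \[f(x^k) - \min_y f(y) \leq \left((1+\lambda L) \|\nabla f^{\lambda, \delta}(x^k)\|+ L \sqrt{d \lambda \delta}\right)\operatorname{dist}(x^k,X^\star).\] \end{enumerate} In all the previous inequalities the quantity $\|\nabla f^{\lambda,\delta}(x^k)\|$ can be bounded as \[ \|\nabla f^{\lambda,\delta}(x^k)\| \le \frac{2\,\operatorname{dist}(x^0,X_{\lambda,\delta}^{\star})}{\lambda(k+1)}, \qquad k\ge 1, \] where $X^\star_{\lambda,\delta}:=\operatorname{argmin} f^{\lambda,\delta}$.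
   Context: Fix $\delta>0$ and $\lambda>0$. The zeroth-order proximal operator is $\operatorname{zprox}^\delta_{\lambda,f}(x)=\frac{\mathbb{E}_{y\sim\mathcal{N}(x,\lambda\delta I)}[y\exp(-f(y)/\delta)]}{\mathbb{E}_{y\sim\mathcal{N}(x,\lambda\delta I)}[\exp(-f(y)/\delta)]}$. The soft Moreau envelope is $f^{\lambda,\delta}(x)=-\delta\log\mathbb{E}_{y\sim\mathcal{N}(x,\lambda\delta I)}[\exp(-f(y)/\delta)]$, which satisfies $\operatorname{zprox}^\delta_{\lambda,f}(x)=x-\lambda\nabla f^{\lambda,\delta}(x)$. $d$ is the dimension, $\operatorname{dist}(x,A)$ is the Euclidean distance from $x$ to the set $A$. A function is $L$-smooth if it is $C^1$ with $L$-Lipschitz gradient. *)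

theory Defs
  imports "HOL-Analysis.Analysis"
begin

definition gauss_density :: "real \<Rightarrow> 'a::euclidean_space \<Rightarrow> 'a \<Rightarrow> real" where
  "gauss_density s x y =
     (2 * pi * s) powr (- real DIM('a) / 2) * exp (- (norm (y - x))\<^sup>2 / (2 * s))"

definition gibbs_mass :: "('a::euclidean_space \<Rightarrow> real) \<Rightarrow> real \<Rightarrow> real \<Rightarrow> 'a \<Rightarrow> real" where
  "gibbs_mass f lam del x =
     (\<integral>y. gauss_density (lam * del) x y * exp (- f y / del) \<partial>lborel)"

definition zprox :: "('a::euclidean_space \<Rightarrow> real) \<Rightarrow> real \<Rightarrow> real \<Rightarrow> 'a \<Rightarrow> 'a" where
  "zprox f lam del x =
     (\<integral>y. (gauss_density (lam * del) x y * exp (- f y / del)) *\<^sub>R y \<partial>lborel)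
       /\<^sub>R gibbs_mass f lam del x"

definition soft_moreau :: "('a::euclidean_space \<Rightarrow> real) \<Rightarrow> real \<Rightarrow> real \<Rightarrow> 'a \<Rightarrow> real" where
  "soft_moreau f lam del x = - del * ln (gibbs_mass f lam del x)"

definition gradient :: "('a::real_inner \<Rightarrow> real) \<Rightarrow> 'a \<Rightarrow> 'a" where
  "gradient F x = (THE D. GDERIV F x :> D)"

definition argmin_set :: "('a \<Rightarrow> real) \<Rightarrow> 'a set" where
  "argmin_set F = {x. \<forall>y. F x \<le> F y}"

definition L_smooth :: "real \<Rightarrow> ('a::real_inner \<Rightarrow> real) \<Rightarrow> bool" where
  "L_smooth L F \<longleftrightarrow> (\<forall>x. F differentiable (at x)) \<and>
     (\<forall>x y. norm (gradient F x - gradient F y) \<le> L * norm (x - y))"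

end

theory Submission
  imports Defs "HOL-Probability.Probability" "HOL-Real_Asymp.Real_Asymp"
begin

text \<open>
  Write \<open>F\<close> for the soft Moreau envelope and \<open>N x\<close> for the probability measure with density
  proportional to \<open>exp (- f y / del - |y - x|^2 / (2 lam del))\<close>, whose mean is the proximal point.
  The Prekopa--Leindler inequality makes \<open>F\<close> midpoint convex, and Jensen's inequality for \<open>exp\<close>
  bounds it above by a quadratic with the slope \<open>p x = (x - E y) / lam\<close>. Together these give
  \<open>\<nabla>F = p\<close> without differentiating under the integral, and show that the iteration is gradient
  descent with step \<open>lam\<close> on a convex \<open>1/lam\<close>-smooth function; hence the rate.
  For (i), shrinking the integration variable towards a point \<open>z\<close> (\<open>y \<mapsto> z + t (y - z)\<close>, \<open>t \<rightarrow> 1\<close>)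
  yields the virial inequality \<open>E [f y - f z + (y - z) \<bullet> (y - x) / lam] \<le> d del\<close>, a substitute
  for integration by parts that needs no smoothness of \<open>f\<close>. With \<open>z\<close> a minimizer it gives (i), and
  with \<open>z\<close> the mean it bounds the variance of \<open>N x\<close> by \<open>d lam del\<close>, which gives (ii).
\<close>

section \<open>The Prekopa--Leindler inequality for midpoints\<close>

text \<open>Each of \<open>A\<close> and \<open>B\<close> is averaged with a point near the top of \<open>A\<close> resp. the bottom of \<open>B\<close>;
  the two resulting half-size copies lie in \<open>C\<close> and overlap only in a tiny interval.\<close>
lemma emeasure_midpoint_bounded:
  fixes A B C :: "real set"
  assumes [measurable]: "A \<in> sets borel" "B \<in> sets borel" "C \<in> sets borel"
    and ne: "A \<noteq> {}" "B \<noteq> {}" and bdd: "bdd_above A" "bdd_below B"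
    and mid: "\<And>a b. a \<in> A \<Longrightarrow> b \<in> B \<Longrightarrow> (a + b) / 2 \<in> C"
  shows "emeasure lborel A + emeasure lborel B \<le> 2 * emeasure lborel C"
proof (rule ennreal_le_epsilon)
  fix e :: real assume e: "0 < e"
  obtain a0 where a0: "a0 \<in> A" "Sup A - e / 2 < a0"
    using less_cSup_iff[OF ne(1) bdd(1), of "Sup A - e / 2"] e by auto
  obtain b0 where b0: "b0 \<in> B" "b0 < Inf B + e / 2"
    using cInf_less_iff[OF ne(2) bdd(2), of "Inf B + e / 2"] e by auto
  define U where "U = {u. - b0 + 2 * u \<in> A}"
  define W where "W = {u. - a0 + 2 * u \<in> B}"
  have [measurable]: "U \<in> sets borel" "W \<in> sets borel"
    unfolding U_def W_def by measurable
  have affine: "emeasure lborel S = 2 * emeasure lborel {u. t + 2 * u \<in> S}"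
    if [measurable]: "S \<in> sets borel" for S :: "real set" and t :: real
  proof -
    have "emeasure lborel S = (\<integral>\<^sup>+u. indicator S u \<partial>lborel)" by simp
    also have "\<dots> = 2 * (\<integral>\<^sup>+u. indicator S (t + 2 * u) \<partial>lborel)"
      by (subst nn_integral_real_affine[where c = 2 and t = t]) auto
    also have "(\<integral>\<^sup>+u. indicator S (t + 2 * u) \<partial>lborel) = (\<integral>\<^sup>+u. indicator {u. t + 2 * u \<in> S} u \<partial>lborel)"
      by (intro nn_integral_cong) (auto simp: indicator_def)
    also have "\<dots> = emeasure lborel {u. t + 2 * u \<in> S}" by simp
    finally show ?thesis .
  qed
  have UC: "U \<subseteq> C"
  proof
    fix u assume "u \<in> U"
    then show "u \<in> C" using mid[of "- b0 + 2 * u" b0] b0 by (simp add: U_def)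
  qed
  have WC: "W \<subseteq> C"
  proof
    fix u assume "u \<in> W"
    then show "u \<in> C" using mid[of a0 "- a0 + 2 * u"] a0 by (simp add: W_def)
  qed
  have UW: "U \<inter> W \<subseteq> {(a0 + b0) / 2 - e / 4 .. (a0 + b0) / 2 + e / 4}"
  proof
    fix u assume u: "u \<in> U \<inter> W"
    have "- b0 + 2 * u \<le> Sup A" using u bdd by (intro cSup_upper) (auto simp: U_def)
    moreover have "Inf B \<le> - a0 + 2 * u" using u bdd by (intro cInf_lower) (auto simp: W_def)
    ultimately show "u \<in> {(a0 + b0) / 2 - e / 4 .. (a0 + b0) / 2 + e / 4}"
      using a0 b0 by (auto simp: field_simps)
  qed
  have "emeasure lborel U + emeasure lborel W = emeasure lborel (U \<union> W) + emeasure lborel (U \<inter> W)"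
    by (rule emeasure_Un_Int) auto
  also have "emeasure lborel (U \<union> W) \<le> emeasure lborel C"
    using UC WC by (intro emeasure_mono) auto
  also have "emeasure lborel (U \<inter> W) \<le> emeasure lborel {(a0 + b0) / 2 - e / 4 .. (a0 + b0) / 2 + e / 4}"
    using UW by (intro emeasure_mono) auto
  also have "\<dots> = ennreal (e / 2)" using e by simp
  finally have *: "emeasure lborel U + emeasure lborel W \<le> emeasure lborel C + ennreal (e / 2)"
    by (simp add: add_mono)
  have "emeasure lborel A + emeasure lborel B = 2 * (emeasure lborel U + emeasure lborel W)"
    using affine[of A "- b0"] affine[of B "- a0"] by (simp add: U_def W_def distrib_left)
  also have "\<dots> \<le> 2 * (emeasure lborel C + ennreal (e / 2))"
    by (intro mult_left_mono *) auto
  also have "\<dots> = 2 * emeasure lborel C + ennreal e"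
    using e by (simp add: distrib_left ennreal_mult[of 2, simplified, symmetric])
  finally show "emeasure lborel A + emeasure lborel B \<le> 2 * emeasure lborel C + ennreal e" .
qed

text \<open>One-dimensional Brunn-Minkowski for midpoints. Cutting \<open>A\<close> off above and
  \<open>B\<close> off below exhausts both sets, so continuity of the measure along increasing
  sequences removes the boundedness requirement while \<open>C\<close> stays fixed.\<close>

lemma emeasure_midpoint:
  fixes A B C :: "real set"
  assumes [measurable]: "A \<in> sets borel" "B \<in> sets borel" "C \<in> sets borel"
    and ne: "A \<noteq> {}" "B \<noteq> {}"
    and mid: "\<And>a b. a \<in> A \<Longrightarrow> b \<in> B \<Longrightarrow> (a + b) / 2 \<in> C"
  shows "emeasure lborel A + emeasure lborel B \<le> 2 * emeasure lborel C"
proof -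
  obtain a b where ab: "a \<in> A" "b \<in> B" using ne by auto
  define An Bn where "An n = A \<inter> {..real n}" and "Bn n = B \<inter> {- real n..}" for n
  have [measurable]: "An n \<in> sets borel" "Bn n \<in> sets borel" for n
    unfolding An_def Bn_def by measurable
  have "(\<Union>n. An n) = A" unfolding An_def using real_arch_simple by auto
  moreover have "incseq An" unfolding An_def incseq_def by auto
  ultimately have A: "(\<lambda>n. emeasure lborel (An n)) \<longlonglongrightarrow> emeasure lborel A"
    using Lim_emeasure_incseq[of An lborel] by (auto simp: image_subset_iff)
  have "x \<in> (\<Union>n. Bn n)" if "x \<in> B" for x
    using real_arch_simple[of "- x"] that by (auto simp: Bn_def minus_le_iff)
  then have "(\<Union>n. Bn n) = B" unfolding Bn_def by auto
  moreover have "incseq Bn" unfolding Bn_def incseq_def by auto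
  ultimately have B: "(\<lambda>n. emeasure lborel (Bn n)) \<longlonglongrightarrow> emeasure lborel B"
    using Lim_emeasure_incseq[of Bn lborel] by (auto simp: image_subset_iff)
  \<comment> \<open>From \<open>N\<close> on, the cut sets contain \<open>a\<close> and
    \<open>b\<close> and are therefore nonempty.\<close>
  obtain N :: nat where N: "\<bar>a\<bar> + \<bar>b\<bar> \<le> real N" using real_arch_simple by blast
  have "emeasure lborel (An n) + emeasure lborel (Bn n) \<le> 2 * emeasure lborel C" if "n \<ge> N" for n
  proof (rule emeasure_midpoint_bounded)
    show "An n \<noteq> {}" "Bn n \<noteq> {}" using ab N that by (auto simp: An_def Bn_def)
    show "bdd_above (An n)" "bdd_below (Bn n)" by (auto simp: An_def Bn_def)
  qed (use mid in \<open>auto simp: An_def Bn_def\<close>)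
  then show ?thesis
    by (intro LIMSEQ_le_const2[OF tendsto_add[OF A B]]) auto
qed

text \<open>\<open>min 1 (u x)\<close> is the length of the set of levels in (0,1) below
  \<open>u x\<close>, and Tonelli exchanges the two integrations. The levels stop at 1 because the
  midpoint inequality for level sets requires them to be nonempty.\<close>

lemma layer_cake_min_one:
  fixes u :: "real \<Rightarrow> ennreal"
  assumes [measurable]: "u \<in> borel_measurable borel"
  shows "(\<integral>\<^sup>+x. min 1 (u x) \<partial>lborel)
    = (\<integral>\<^sup>+s. indicator {0<..<1} s * emeasure lborel {x. ennreal s < u x} \<partial>lborel)"
proof -
  have "min 1 (u x) = (\<integral>\<^sup>+s. indicator {0<..<1} s * indicator {x. ennreal s < u x} x \<partial>lborel)" for x
  proof -
    \<comment> \<open>\<open>r\<close> is \<open>min 1 (u x)\<close> read as a real number; an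
      infinite \<open>u x\<close> gives \<open>r = 1\<close>.\<close>
    have "\<exists>r. 0 \<le> r \<and> min 1 (u x) = ennreal r \<and> {s. 0 < s \<and> s < 1 \<and> ennreal s < u x} = {0<..<r}"
    proof (cases "u x")
      case (real r)
      show ?thesis
        using real by (intro exI[of _ "min 1 r"]) (auto simp: ennreal_less_iff min_def simp flip: ennreal_1)
    next
      case top
      then show ?thesis by (intro exI[of _ 1]) (auto simp: min_def)
    qed
    then obtain r where r: "0 \<le> r" "min 1 (u x) = ennreal r"
      "{s. 0 < s \<and> s < 1 \<and> ennreal s < u x} = {0<..<r}" by auto
    have "(\<integral>\<^sup>+s. indicator {0<..<1} s * indicator {x. ennreal s < u x} x \<partial>lborel)
       = (\<integral>\<^sup>+s. indicator {s. 0 < s \<and> s < 1 \<and> ennreal s < u x} s \<partial>lborel)"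
      by (intro nn_integral_cong) (auto simp: indicator_def)
    then show ?thesis using r by simp
  qed
  then have "(\<integral>\<^sup>+x. min 1 (u x) \<partial>lborel)
     = (\<integral>\<^sup>+x. (\<integral>\<^sup>+s. indicator {0<..<1} s * indicator {x. ennreal s < u x} x \<partial>lborel) \<partial>lborel)" by simp
  also have "\<dots> = (\<integral>\<^sup>+s. (\<integral>\<^sup>+x. indicator {0<..<1} s * indicator {x. ennreal s < u x} x \<partial>lborel) \<partial>lborel)"
  proof (rule lborel_pair.Fubini')
    show "(\<lambda>(s, x). indicator {0<..<1} s * indicator {x. ennreal s < u x} x :: ennreal) \<in> borel_measurable (lborel \<Otimes>\<^sub>M lborel)"
      unfolding indicator_def of_bool_def mem_Collect_eq greaterThanLessThan_iff by measurable
  qed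
  also have "\<dots> = (\<integral>\<^sup>+s. indicator {0<..<1} s * emeasure lborel {x. ennreal s < u x} \<partial>lborel)"
    by (intro nn_integral_cong) (simp add: nn_integral_cmult)
  finally show ?thesis .
qed

text \<open>Sends midpoints of superlevel sets of \<open>f\<close> and \<open>g\<close> into the
  superlevel set of \<open>h\<close> at the same height. An infinite factor is treated apart; the
  other factor exceeds \<open>s\<close>, hence is nonzero, and the product is infinite.\<close>

lemma ennreal_mult_less_power2_imp:
  fixes s :: real and a b c :: ennreal
  assumes "0 \<le> s" "ennreal s < a" "ennreal s < b" "a * b \<le> c\<^sup>2"
  shows "ennreal s < c"
proof (rule ccontr)
  assume "\<not> ennreal s < c"
  then have "c\<^sup>2 \<le> (ennreal s)\<^sup>2" by (intro power_mono) auto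
  with assms(4) have le: "a * b \<le> ennreal (s * s)"
    using assms(1) by (simp add: power2_eq_square ennreal_mult)
  show False
  proof (cases "a = top \<or> b = top")
    case True
    then have "a * b = top" using assms by (auto simp: ennreal_top_mult ennreal_mult_top)
    with le show False by (simp add: top_unique)
  next
    case False
    then obtain p q where pq: "a = ennreal p" "0 \<le> p" "b = ennreal q" "0 \<le> q"
      by (metis ennreal_cases)
    then have "s * s < p * q" using assms by (intro mult_strict_mono') (auto simp: ennreal_less_iff)
    with le pq assms(1) show False by (simp flip: ennreal_mult)
  qed
qed

text \<open>With both suprema equal to 1, all level sets of \<open>f\<close> and \<open>g\<close> at
  heights in (0,1) are nonempty, so the midpoint inequality for sets can be integrated over the
  heights. Cutting at 1 leaves \<open>f\<close> and \<open>g\<close> unchanged and only lowers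
  \<open>h\<close>. The result is additive, which is stronger than the product form.\<close>

lemma prekopa_leindler_normalized:
  fixes f g h :: "real \<Rightarrow> ennreal"
  assumes [measurable]: "f \<in> borel_measurable borel" "g \<in> borel_measurable borel" "h \<in> borel_measurable borel"
    and sup: "(SUP x. f x) = 1" "(SUP x. g x) = 1"
    and mid: "\<And>x y. f x * g y \<le> (h ((x + y) / 2))\<^sup>2"
  shows "(\<integral>\<^sup>+x. f x \<partial>lborel) + (\<integral>\<^sup>+x. g x \<partial>lborel) \<le> 2 * (\<integral>\<^sup>+x. h x \<partial>lborel)"
proof -
  have le: "min 1 (f x) = f x" "min 1 (g x) = g x" for x
    using sup SUP_upper[of x UNIV f] SUP_upper[of x UNIV g] by (auto simp: min_def)
  have level: "emeasure lborel {x. ennreal s < f x} + emeasure lborel {x. ennreal s < g x}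
      \<le> 2 * emeasure lborel {x. ennreal s < h x}" if s: "0 < s" "s < 1" for s
  proof (rule emeasure_midpoint)
    have "ennreal s < 1" using s by (simp add: ennreal_less_iff flip: ennreal_1)
    then show "{x. ennreal s < f x} \<noteq> {}" "{x. ennreal s < g x} \<noteq> {}"
      using sup less_SUP_iff[of "ennreal s" f UNIV] less_SUP_iff[of "ennreal s" g UNIV] by auto
    fix a b assume "a \<in> {x. ennreal s < f x}" "b \<in> {x. ennreal s < g x}"
    then show "(a + b) / 2 \<in> {x. ennreal s < h x}"
      using ennreal_mult_less_power2_imp[OF _ _ _ mid] s by simp
  qed measurable
  have "(\<integral>\<^sup>+x. f x \<partial>lborel) + (\<integral>\<^sup>+x. g x \<partial>lborel)
      = (\<integral>\<^sup>+x. min 1 (f x) \<partial>lborel) + (\<integral>\<^sup>+x. min 1 (g x) \<partial>lborel)"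
    by (simp add: le)
  also have "\<dots> = (\<integral>\<^sup>+s. indicator {0<..<1} s * emeasure lborel {x. ennreal s < f x}
        + indicator {0<..<1} s * emeasure lborel {x. ennreal s < g x} \<partial>lborel)"
    by (subst nn_integral_add) (auto simp: layer_cake_min_one)
  also have "\<dots> \<le> (\<integral>\<^sup>+s. 2 * (indicator {0<..<1} s * emeasure lborel {x. ennreal s < h x}) \<partial>lborel)"
    using level by (intro nn_integral_mono) (auto simp: indicator_def)
  also have "\<dots> = 2 * (\<integral>\<^sup>+x. min 1 (h x) \<partial>lborel)"
    by (subst nn_integral_cmult) (auto simp: layer_cake_min_one)
  also have "\<dots> \<le> 2 * (\<integral>\<^sup>+x. h x \<partial>lborel)"
    by (intro mult_left_mono nn_integral_mono) auto
  finally show ?thesis .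
qed

lemma ennreal_amgm: "4 * (a * b) \<le> (a + b)\<^sup>2" for a b :: ennreal
proof (cases a; cases b)
  fix r s assume rs: "a = ennreal r" "0 \<le> r" "b = ennreal s" "0 \<le> s"
  have "4 * (r * s) \<le> (r + s)\<^sup>2" using zero_le_power2[of "r - s"] by (simp add: power2_eq_square algebra_simps)
  then have "ennreal (4 * (r * s)) \<le> ennreal ((r + s)\<^sup>2)" by (rule ennreal_leI)
  then show ?thesis using rs by (simp add: ennreal_mult ennreal_power flip: ennreal_plus)
qed (auto simp: power2_eq_square ennreal_mult_top)

text \<open>\<open>f\<close> and \<open>g\<close> are divided by their suprema \<open>a\<close> and
  \<open>b\<close>. The factor \<open>c\<close> for \<open>h\<close> is the geometric mean of
  \<open>1 / a\<close> and \<open>1 / b\<close>, so the hypothesis survives the scaling; AM-GM turns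
  the additive bound into a product and the factor \<open>c\<close> squared cancels.\<close>

lemma prekopa_leindler_bounded:
  fixes f g h :: "real \<Rightarrow> ennreal"
  assumes [measurable]: "f \<in> borel_measurable borel" "g \<in> borel_measurable borel" "h \<in> borel_measurable borel"
    and bdd: "(SUP x. f x) < top" "(SUP x. g x) < top"
    and mid: "\<And>x y. f x * g y \<le> (h ((x + y) / 2))\<^sup>2"
  shows "(\<integral>\<^sup>+x. f x \<partial>lborel) * (\<integral>\<^sup>+x. g x \<partial>lborel) \<le> (\<integral>\<^sup>+x. h x \<partial>lborel)\<^sup>2"
proof (cases "(SUP x. f x) = 0 \<or> (SUP x. g x) = 0")
  case True
  then have "(\<forall>x. f x = 0) \<or> (\<forall>x. g x = 0)"
    using SUP_upper[of _ UNIV f] SUP_upper[of _ UNIV g] by (metis UNIV_I le_zero_eq)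
  then show ?thesis by auto
next
  case False
  obtain a where a: "(SUP x. f x) = ennreal a" "a > 0"
    using False bdd(1) by (cases "SUP x. f x") (auto simp: less_le)
  obtain b where b: "(SUP x. g x) = ennreal b" "b > 0"
    using False bdd(2) by (cases "SUP x. g x") (auto simp: less_le)
  define c where "c = 1 / sqrt (a * b)"
  have c: "c > 0" "c\<^sup>2 = (1 / a) * (1 / b)" using a b by (auto simp: c_def power_divide)
  let ?F = "\<integral>\<^sup>+x. f x \<partial>lborel" and ?G = "\<integral>\<^sup>+x. g x \<partial>lborel" and ?H = "\<integral>\<^sup>+x. h x \<partial>lborel"
  have cc: "ennreal (1 / a) * ennreal (1 / b) = (ennreal c)\<^sup>2"
    using a b c by (simp add: ennreal_power flip: ennreal_mult)
  have "(\<integral>\<^sup>+x. ennreal (1 / a) * f x \<partial>lborel) + (\<integral>\<^sup>+x. ennreal (1 / b) * g x \<partial>lborel)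
      \<le> 2 * (\<integral>\<^sup>+x. ennreal c * h x \<partial>lborel)"
  proof (rule prekopa_leindler_normalized)
    show "(SUP x. ennreal (1 / a) * f x) = 1" "(SUP x. ennreal (1 / b) * g x) = 1"
      using a b by (auto simp: SUP_mult_left_ennreal[symmetric] simp flip: ennreal_mult)
    fix x y
    have "ennreal (1 / a) * f x * (ennreal (1 / b) * g y) = (ennreal c)\<^sup>2 * (f x * g y)"
      by (simp add: cc[symmetric] mult_ac)
    also have "\<dots> \<le> (ennreal c)\<^sup>2 * (h ((x + y) / 2))\<^sup>2" by (intro mult_left_mono mid) auto
    finally show "ennreal (1 / a) * f x * (ennreal (1 / b) * g y) \<le> (ennreal c * h ((x + y) / 2))\<^sup>2"
      by (simp add: power_mult_distrib)
  qed measurable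
  then have le: "ennreal (1 / a) * ?F + ennreal (1 / b) * ?G \<le> 2 * (ennreal c * ?H)"
    by (simp add: nn_integral_cmult)
  have "4 * ((ennreal c)\<^sup>2 * (?F * ?G)) = 4 * ((ennreal (1 / a) * ?F) * (ennreal (1 / b) * ?G))"
    by (simp add: cc[symmetric] mult_ac)
  also have "\<dots> \<le> (ennreal (1 / a) * ?F + ennreal (1 / b) * ?G)\<^sup>2" by (rule ennreal_amgm)
  also have "\<dots> \<le> (2 * (ennreal c * ?H))\<^sup>2" using le by (rule power_mono) auto
  also have "\<dots> = 4 * ((ennreal c)\<^sup>2 * ?H\<^sup>2)" by (simp add: power_mult_distrib)
  finally have "(ennreal c)\<^sup>2 * (?F * ?G) \<le> (ennreal c)\<^sup>2 * ?H\<^sup>2"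
    by (subst (asm) ennreal_mult_le_mult_iff) auto
  then show ?thesis
    using c(1) by (subst (asm) ennreal_mult_le_mult_iff) (auto simp: ennreal_power)
qed

text \<open>Cutting \<open>f\<close> and \<open>g\<close> at height \<open>n\<close> gives bounded
  functions, and monotone convergence recovers their integrals.\<close>

lemma prekopa_leindler_real:
  fixes f g h :: "real \<Rightarrow> ennreal"
  assumes [measurable]: "f \<in> borel_measurable borel" "g \<in> borel_measurable borel" "h \<in> borel_measurable borel"
    and mid: "\<And>x y. f x * g y \<le> (h ((x + y) / 2))\<^sup>2"
  shows "(\<integral>\<^sup>+x. f x \<partial>lborel) * (\<integral>\<^sup>+x. g x \<partial>lborel) \<le> (\<integral>\<^sup>+x. h x \<partial>lborel)\<^sup>2"
proof -
  have lim: "(\<lambda>n. \<integral>\<^sup>+x. min (of_nat n) (u x) \<partial>lborel) \<longlonglongrightarrow> (\<integral>\<^sup>+x. u x \<partial>lborel)"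
    if [measurable]: "u \<in> borel_measurable borel" for u :: "real \<Rightarrow> ennreal"
  proof (rule nn_integral_LIMSEQ)
    show "incseq (\<lambda>n x. min (of_nat n) (u x))"
      by (auto simp: incseq_def le_fun_def min_def) (meson of_nat_mono order_trans)+
    fix x
    have "(\<lambda>n. min (of_nat n) (u x)) \<longlonglongrightarrow> min top (u x)"
      by (intro tendsto_min of_nat_tendsto_top_ennreal tendsto_const)
    then show "(\<lambda>n. min (of_nat n) (u x)) \<longlonglongrightarrow> u x" by (simp add: min_def top_unique)
  qed simp
  have "(\<integral>\<^sup>+x. min (of_nat n) (f x) \<partial>lborel) * (\<integral>\<^sup>+x. min (of_nat n) (g x) \<partial>lborel)
      \<le> (\<integral>\<^sup>+x. h x \<partial>lborel)\<^sup>2" for n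
  proof (rule prekopa_leindler_bounded)
    have "(SUP x. min (of_nat n) (u x)) \<le> of_nat n" for u :: "real \<Rightarrow> ennreal" by (intro SUP_least) auto
    then show "(SUP x. min (of_nat n) (f x)) < top" "(SUP x. min (of_nat n) (g x)) < top"
      by (meson le_less_trans of_nat_less_top)+
    fix x y
    have "min (of_nat n) (f x) * min (of_nat n) (g y) \<le> f x * g y" by (intro mult_mono) auto
    also note mid
    finally show "min (of_nat n) (f x) * min (of_nat n) (g y) \<le> (h ((x + y) / 2))\<^sup>2" .
  qed measurable
  note bound = this
  show ?thesis
  \<comment> \<open>Multiplication on \<open>ennreal\<close> is discontinuous at zero times
    infinity, so a vanishing integral is treated before passing to the limit in the product.\<close>
  proof (cases "(\<integral>\<^sup>+x. f x \<partial>lborel) = 0 \<or> (\<integral>\<^sup>+x. g x \<partial>lborel) = 0")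
    case True
    then show ?thesis by auto
  next
    case False
    then show ?thesis
      by (intro LIMSEQ_le_const2[OF tendsto_mult_ennreal[OF lim lim]]) (use bound in auto)
  qed
qed

text \<open>The inequality tensorizes: by the induction hypothesis, integrating out the coordinates
  in \<open>I\<close> leaves three functions of the coordinate \<open>i\<close> that satisfy the
  one-dimensional hypothesis.\<close>

lemma prekopa_leindler_PiM:
  fixes f g h :: "('i \<Rightarrow> real) \<Rightarrow> ennreal"
  assumes "finite I"
    and "f \<in> borel_measurable (Pi\<^sub>M I (\<lambda>_. lborel))" "g \<in> borel_measurable (Pi\<^sub>M I (\<lambda>_. lborel))"
      "h \<in> borel_measurable (Pi\<^sub>M I (\<lambda>_. lborel))"
    and "\<And>x y. x \<in> extensional I \<Longrightarrow> y \<in> extensional I \<Longrightarrow> f x * g y \<le> (h (\<lambda>i\<in>I. (x i + y i) / 2))\<^sup>2"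
  shows "(\<integral>\<^sup>+x. f x \<partial>Pi\<^sub>M I (\<lambda>_. lborel)) * (\<integral>\<^sup>+x. g x \<partial>Pi\<^sub>M I (\<lambda>_. lborel))
    \<le> (\<integral>\<^sup>+x. h x \<partial>Pi\<^sub>M I (\<lambda>_. lborel))\<^sup>2"
  using assms
proof (induction I arbitrary: f g h rule: finite_induct)
  case empty
  interpret product_sigma_finite "\<lambda>_. lborel :: real measure" ..
  \<comment> \<open>The empty product consists of the single point
    \<open>\<lambda>_. undefined\<close>, where the claim is the pointwise hypothesis.\<close>
  show ?case using empty(4)[of "\<lambda>_. undefined" "\<lambda>_. undefined"]
    by (simp add: nn_integral_empty restrict_def)
next
  case (insert i I)
  interpret product_sigma_finite "\<lambda>_. lborel :: real measure" ..
  note [measurable] = insert.prems(1-3)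
  interpret I: finite_product_sigma_finite "\<lambda>_. lborel :: real measure" I
    by standard (rule insert.hyps)
  let ?P = "Pi\<^sub>M I (\<lambda>_. lborel :: real measure)"
  have upd: "(\<lambda>x. u (x(i := t))) \<in> borel_measurable ?P"
    if "u \<in> borel_measurable (Pi\<^sub>M (insert i I) (\<lambda>_. lborel))" for u :: "('i \<Rightarrow> real) \<Rightarrow> ennreal" and t
    using that by measurable
  have marg: "(\<lambda>t. \<integral>\<^sup>+x. u (x(i := t)) \<partial>?P) \<in> borel_measurable borel"
    if [measurable]: "u \<in> borel_measurable (Pi\<^sub>M (insert i I) (\<lambda>_. lborel))" for u :: "('i \<Rightarrow> real) \<Rightarrow> ennreal"
  proof -
    have "(\<lambda>t. \<integral>\<^sup>+x. u (x(i := t)) \<partial>?P) \<in> borel_measurable (lborel :: real measure)"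
      by measurable
    then show ?thesis by simp
  qed
  have inner: "(\<integral>\<^sup>+x. f (x(i := s)) \<partial>?P) * (\<integral>\<^sup>+x. g (x(i := t)) \<partial>?P)
      \<le> (\<integral>\<^sup>+x. h (x(i := (s + t) / 2)) \<partial>?P)\<^sup>2" for s t
  proof (rule insert.IH)
    fix x y :: "'i \<Rightarrow> real" assume xy: "x \<in> extensional I" "y \<in> extensional I"
    have "(\<lambda>j\<in>insert i I. ((x(i := s)) j + (y(i := t)) j) / 2) = (\<lambda>j\<in>I. (x j + y j) / 2)(i := (s + t) / 2)"
      using insert.hyps by (auto simp: fun_eq_iff)
    moreover have "x(i := s) \<in> extensional (insert i I)" "y(i := t) \<in> extensional (insert i I)"
      using xy by (auto simp: extensional_def)
    ultimately show "f (x(i := s)) * g (y(i := t)) \<le> (h ((\<lambda>j\<in>I. (x j + y j) / 2)(i := (s + t) / 2)))\<^sup>2"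
      using insert.prems(4)[of "x(i := s)" "y(i := t)"] by (simp del: fun_upd_apply)
  qed (intro upd insert.prems)+
  show ?case
    unfolding product_nn_integral_insert_rev[OF insert.hyps(1,2) insert.prems(1)]
      product_nn_integral_insert_rev[OF insert.hyps(1,2) insert.prems(2)]
      product_nn_integral_insert_rev[OF insert.hyps(1,2) insert.prems(3)]
    by (rule prekopa_leindler_real[OF marg marg marg inner]) (fact insert.prems)+
qed

text \<open>\<open>lborel\<close> is the image of the product measure under the coordinate map
  \<open>e\<close>, which respects midpoints.\<close>

lemma prekopa_leindler:
  fixes f g h :: "'a::euclidean_space \<Rightarrow> ennreal"
  assumes [measurable]: "f \<in> borel_measurable borel" "g \<in> borel_measurable borel" "h \<in> borel_measurable borel"
    and mid: "\<And>x y. f x * g y \<le> (h ((1/2) *\<^sub>R (x + y)))\<^sup>2"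
  shows "(\<integral>\<^sup>+x. f x \<partial>lborel) * (\<integral>\<^sup>+x. g x \<partial>lborel) \<le> (\<integral>\<^sup>+x. h x \<partial>lborel)\<^sup>2"
proof -
  define e where "e x = (\<Sum>b\<in>Basis. x b *\<^sub>R b)" for x :: "'a \<Rightarrow> real"
  have [measurable]: "e \<in> measurable (Pi\<^sub>M Basis (\<lambda>_. lborel)) borel" unfolding e_def by measurable
  have "(\<integral>\<^sup>+x. f (e x) \<partial>Pi\<^sub>M Basis (\<lambda>_. lborel)) * (\<integral>\<^sup>+x. g (e x) \<partial>Pi\<^sub>M Basis (\<lambda>_. lborel))
    \<le> (\<integral>\<^sup>+x. h (e x) \<partial>Pi\<^sub>M Basis (\<lambda>_. lborel))\<^sup>2"
  proof (rule prekopa_leindler_PiM)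
    fix x y :: "'a \<Rightarrow> real"
    have "e (\<lambda>i\<in>Basis. (x i + y i) / 2) = (1/2) *\<^sub>R (e x + e y)"
      by (simp add: e_def scaleR_sum_right scaleR_add_left sum.distrib[symmetric] scaleR_add_right add_divide_distrib
           cong: sum.cong)
    then show "f (e x) * g (e y) \<le> (h (e (\<lambda>i\<in>Basis. (x i + y i) / 2)))\<^sup>2" using mid by simp
  qed (simp, measurable)
  moreover have "(\<integral>\<^sup>+x. u x \<partial>lborel) = (\<integral>\<^sup>+x. u (e x) \<partial>Pi\<^sub>M Basis (\<lambda>_. lborel))"
    if [measurable]: "u \<in> borel_measurable borel" for u :: "'a \<Rightarrow> ennreal"
    by (simp add: lborel_eq[where 'a = 'a] nn_integral_distr flip: e_def)
  ultimately show ?thesis by simp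
qed

section \<open>Gradient descent and first-order convexity\<close>

lemma power2_norm_diff: "(norm (a - b))\<^sup>2 = (norm a)\<^sup>2 + (norm b)\<^sup>2 - 2 * (a \<bullet> b)"
  for a b :: "'a::real_inner"
  by (simp add: power2_norm_eq_inner inner_diff_left inner_diff_right inner_commute)

text \<open>The gaps \<open>D j\<close> are bounded twice. Telescoping squared distances to
  \<open>m\<close> bounds their sum above; since gradient norms decrease, each step costs at least
  \<open>lam * G\<close>, so the gaps grow linearly when read backwards from
  \<open>k\<close>.\<close>

lemma gradient_descent_rate:
  fixes F :: "'a::real_inner \<Rightarrow> real" and p :: "'a \<Rightarrow> 'a"
  assumes lam: "lam > 0"
    and below: "\<And>x z. F x + p x \<bullet> (z - x) \<le> F z"
    and above: "\<And>x z. F z \<le> F x + p x \<bullet> (z - x) + (norm (z - x))\<^sup>2 / (2 * lam)"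
    and iter: "\<And>k. x (Suc k) = x k - lam *\<^sub>R p (x k)"
    and min: "\<And>y. F m \<le> F y"
  shows "lam * (real k + 1) * norm (p (x k)) \<le> norm (x 0 - m)"
proof -
  \<comment> \<open>The point \<open>v - lam *\<^sub>R q\<close> minimizes the quadratic upper model
    at \<open>v\<close> minus the tangent at \<open>u\<close>; upper and lower bound are compared
    there.\<close>
  have cocoercive: "F u + p u \<bullet> (v - u) + lam / 2 * (norm (p v - p u))\<^sup>2 \<le> F v" for u v
  proof -
    define q where "q = p v - p u"
    have "F u + p u \<bullet> (v - lam *\<^sub>R q - u) \<le> F v + p v \<bullet> (- lam *\<^sub>R q) + (norm (lam *\<^sub>R q))\<^sup>2 / (2 * lam)"
      using below[of u "v - lam *\<^sub>R q"] above[of "v - lam *\<^sub>R q" v] by simp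
    moreover have "p v \<bullet> q - p u \<bullet> q = q \<bullet> q" by (simp add: q_def inner_diff_left inner_diff_right)
    then have "lam * (p v \<bullet> q) = lam * (p u \<bullet> q) + lam * (q \<bullet> q)" by (simp flip: distrib_left)
    moreover have "(norm (lam *\<^sub>R q))\<^sup>2 / (2 * lam) = lam / 2 * (q \<bullet> q)"
      using lam by (simp add: power_mult_distrib power2_eq_square flip: power2_norm_eq_inner)
    ultimately show ?thesis
      by (simp add: inner_diff_right power2_norm_eq_inner flip: q_def)
  qed
  \<comment> \<open>Otherwise a gradient step from \<open>m\<close> would decrease \<open>F\<close>
    strictly.\<close>
  have pm: "p m = 0"
  proof -
    have "F m \<le> F m + p m \<bullet> (- lam *\<^sub>R p m) + (norm (lam *\<^sub>R p m))\<^sup>2 / (2 * lam)"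
      using min[of "m - lam *\<^sub>R p m"] above[of "m - lam *\<^sub>R p m" m] by simp
    also have "\<dots> = F m - lam / 2 * (p m \<bullet> p m)"
      using lam by (simp add: power_mult_distrib power2_eq_square flip: power2_norm_eq_inner)
    finally have "p m \<bullet> p m \<le> 0" using lam by (simp add: mult_le_0_iff)
    then show ?thesis by (simp add: power2_norm_eq_inner[symmetric])
  qed
  define g where "g k = p (x k)" for k
  define D where "D k = F (x k) - F m" for k
  have step: "x (Suc k) - x k = - lam *\<^sub>R g k" "x k - x (Suc k) = lam *\<^sub>R g k" for k
    by (simp_all add: iter g_def)
  \<comment> \<open>Adding cocoercivity in both directions between consecutive iterates bounds the
    squared norm of \<open>g (Suc k)\<close> by \<open>g k \<bullet> g (Suc k)\<close>.\<close>
  have dec: "norm (g (Suc k)) \<le> norm (g k)" for k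
  proof -
    have "lam * (norm (g k - g (Suc k)))\<^sup>2 \<le> lam * (g k \<bullet> (g k - g (Suc k)))"
      using cocoercive[of "x k" "x (Suc k)"] cocoercive[of "x (Suc k)" "x k"]
      by (simp add: step inner_diff_right inner_commute[of "g (Suc k)" "g k"]
          norm_minus_commute[of "g (Suc k)" "g k"] right_diff_distrib flip: g_def)
    then have "(norm (g k - g (Suc k)))\<^sup>2 \<le> g k \<bullet> (g k - g (Suc k))" using lam by simp
    then have "g (Suc k) \<bullet> g (Suc k) \<le> g k \<bullet> g (Suc k)"
      by (simp add: power2_norm_eq_inner inner_diff_left inner_diff_right inner_commute[of "g (Suc k)" "g k"])
    then have "norm (g (Suc k)) * norm (g (Suc k)) \<le> g k \<bullet> g (Suc k)"
      by (simp only: power2_norm_eq_inner[symmetric] power2_eq_square[symmetric])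
    also have "\<dots> \<le> norm (g k) * norm (g (Suc k))" by (rule norm_cauchy_schwarz)
    finally show ?thesis by (cases "g (Suc k) = 0") auto
  qed
  have mono: "norm (g k) \<le> norm (g j)" if "j \<le> k" for j
    using lift_Suc_antimono_le[of "\<lambda>k. norm (g k)", OF dec] that by blast
  \<comment> \<open>The step length \<open>lam\<close> is exactly the one for which the cross term
    \<open>g j \<bullet> g (Suc j)\<close> cancels.\<close>
  have drop: "D (Suc j) + lam / 2 * ((norm (g j))\<^sup>2 + (norm (g (Suc j)))\<^sup>2) \<le> D j" for j
    using cocoercive[of "x (Suc j)" "x j"]
    by (simp add: D_def step power2_norm_eq_inner inner_diff_left inner_diff_right
        inner_commute[of "g (Suc j)" "g j"] distrib_left right_diff_distrib flip: g_def)
  \<comment> \<open>Cocoercivity against \<open>m\<close>, where \<open>p\<close> vanishes, matches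
    the expansion of the squared distance after one step.\<close>
  have dist: "2 * lam * D j \<le> (norm (x j - m))\<^sup>2 - (norm (x (Suc j) - m))\<^sup>2" for j
  proof -
    have "D j \<le> g j \<bullet> (x j - m) - lam / 2 * (norm (g j))\<^sup>2"
      using cocoercive[of "x j" m] by (simp add: D_def pm g_def inner_diff_right)
    then have "2 * lam * D j \<le> 2 * lam * (g j \<bullet> (x j - m) - lam / 2 * (norm (g j))\<^sup>2)"
      using lam by simp
    also have "\<dots> = (norm (x j - m))\<^sup>2 - (norm (x (Suc j) - m))\<^sup>2"
    proof -
      have "x (Suc j) - m = (x j - m) - lam *\<^sub>R g j" by (simp add: iter g_def)
      then have "(norm (x (Suc j) - m))\<^sup>2 = (norm (x j - m))\<^sup>2 - 2 * (lam * (g j \<bullet> (x j - m))) + lam\<^sup>2 * (norm (g j))\<^sup>2"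
        by (simp only: power2_norm_diff) (simp add: inner_commute[of _ "g j"] power_mult_distrib)
      then show ?thesis by (simp add: right_diff_distrib power2_eq_square)
    qed
    finally show ?thesis .
  qed
  define G where "G = (norm (g k))\<^sup>2"
  have Gj: "G \<le> (norm (g j))\<^sup>2" if "j \<le> k" for j
    unfolding G_def using mono[OF that] by (rule power_mono) auto
  text \<open>Summing these lower bounds gives the square \<open>(k + 1)\<^sup>2 / 2\<close>, whose root is the rate.\<close>
  have lower: "lam * G * (real i + 1 / 2) \<le> D (k - i)" if "i \<le> k" for i
    using that
  proof (induction i)
    case 0
    have "lam / 2 * G \<le> D k"
      using cocoercive[of m "x k"] by (simp add: D_def pm G_def g_def)
    then show ?case by simp
  next
    case (Suc i)
    have "lam / 2 * (G + G) \<le> lam / 2 * ((norm (g (k - Suc i)))\<^sup>2 + (norm (g (k - i)))\<^sup>2)"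
      using lam Suc.prems by (intro mult_left_mono add_mono Gj) auto
    then show ?case using Suc drop[of "k - Suc i"] by (simp add: Suc_diff_Suc algebra_simps)
  qed
  have sum_lower: "lam * G * real n ^ 2 / 2 \<le> (\<Sum>i<n. D (k - i))" if "n \<le> Suc k" for n
    using that
  proof (induction n)
    case (Suc n)
    then show ?case using lower[of n] by (simp add: power2_eq_square algebra_simps)
  qed simp
  have sum_upper: "2 * lam * (\<Sum>j<n. D j) \<le> (norm (x 0 - m))\<^sup>2 - (norm (x n - m))\<^sup>2" for n
  proof (induction n)
    case (Suc n)
    then show ?case using dist[of n] by (simp add: algebra_simps)
  qed simp
  have "(\<Sum>i<Suc k. D (k - i)) = (\<Sum>j<Suc k. D j)"
    using sum.nat_diff_reindex[of D "Suc k"] by simp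
  then have "2 * lam * (lam * G * real (Suc k) ^ 2 / 2) \<le> (norm (x 0 - m))\<^sup>2"
    using sum_lower[of "Suc k"] sum_upper[of "Suc k"] lam
    by (smt (verit) le_refl mult_left_mono zero_le_power2)
  then have "(lam * (real k + 1) * norm (g k))\<^sup>2 \<le> (norm (x 0 - m))\<^sup>2"
    by (simp add: G_def power_mult_distrib power2_eq_square algebra_simps)
  then show ?thesis
    unfolding g_def by (rule power2_le_imp_le) simp
qed

section \<open>The Gibbs measure and the soft Moreau envelope\<close>

text \<open>The squared norm splits over the basis, so the integral factors into one-dimensional
  normal densities of variance \<open>1 / (2 * c)\<close>.\<close>

lemma integrable_gaussian:
  fixes x :: "'a::euclidean_space"
  assumes "c > 0"
  shows "integrable lborel (\<lambda>y. exp (- (c * (norm (y - x))\<^sup>2)))"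
proof (rule integrableI_bounded)
  have 1: "(\<integral>\<^sup>+t. ennreal (exp (- (c * (t - a)\<^sup>2))) \<partial>lborel) < \<infinity>" for a :: real
  proof -
    define \<sigma> where "\<sigma> = 1 / sqrt (2 * c)"
    have \<sigma>: "\<sigma> > 0" "\<sigma>\<^sup>2 = 1 / (2 * c)" using assms by (auto simp: \<sigma>_def power_divide)
    have "integrable lborel (\<lambda>t. sqrt (2 * pi * \<sigma>\<^sup>2) * normal_density a \<sigma> t)"
      using \<sigma> by (intro integrable_mult_right integrable_normal_density)
    also have "(\<lambda>t. sqrt (2 * pi * \<sigma>\<^sup>2) * normal_density a \<sigma> t) = (\<lambda>t. exp (- (c * (t - a)\<^sup>2)))"
      using \<sigma> assms by (auto simp: normal_density_def fun_eq_iff)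
    finally show ?thesis unfolding integrable_iff_bounded by simp
  qed
  have "(norm (y - x))\<^sup>2 = (\<Sum>b\<in>Basis. (y \<bullet> b - x \<bullet> b)\<^sup>2)" for y
    unfolding power2_norm_eq_inner
    by (subst euclidean_inner) (simp add: inner_diff_left power2_eq_square)
  then have "ennreal (norm (exp (- (c * (norm (y - x))\<^sup>2))))
      = (\<Prod>b\<in>Basis. ennreal (exp (- (c * (y \<bullet> b - x \<bullet> b)\<^sup>2))))" for y
    by (simp add: prod_ennreal exp_sum[symmetric] sum_distrib_left sum_negf)
  then have "(\<integral>\<^sup>+y. ennreal (norm (exp (- (c * (norm (y - x))\<^sup>2)))) \<partial>lborel)
      = (\<Prod>b\<in>Basis. (\<integral>\<^sup>+t. ennreal (exp (- (c * (t - x \<bullet> b)\<^sup>2))) \<partial>lborel))"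
    using nn_integral_lborel_prod[of "\<lambda>b t. ennreal (exp (- (c * (t - x \<bullet> b)\<^sup>2)))"] by simp
  also have "\<dots> < \<infinity>" using 1 by (simp add: ennreal_prod_eq_top less_top[symmetric])
  finally show "(\<integral>\<^sup>+y. ennreal (norm (exp (- (c * (norm (y - x))\<^sup>2)))) \<partial>lborel) < \<infinity>" .
qed simp

text \<open>Lets an exponential weight absorb a factor of linear growth at the price of a
  constant.\<close>

lemma mult_exp_neg_le: 
  fixes u c :: real assumes "c > 0" shows "u * exp (- u / c) \<le> c"
proof -
  have "u / c \<le> exp (u / c)" using exp_ge_add_one_self[of "u / c"] by linarith
  then have "u / c * exp (- u / c) \<le> exp (u / c) * exp (- u / c)" by (intro mult_right_mono) auto
  also have "\<dots> = 1" by (simp add: exp_minus_inverse)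
  finally show ?thesis using assms by (simp add: field_simps)
qed

section \<open>Gradients, tangent inequalities and midpoint convexity\<close>

lemma has_derivative_squeeze_quadratic:
  fixes F :: "'a::real_inner \<Rightarrow> real"
  assumes "\<And>h. \<bar>F (x + h) - F x - p \<bullet> h\<bar> \<le> C * (norm h)\<^sup>2"
  shows "GDERIV F x :> p"
  unfolding gderiv_def has_derivative_at
proof (intro conjI)
  show "bounded_linear (\<lambda>h. h \<bullet> p)" by (rule bounded_linear_inner_left)
  show "(\<lambda>h. norm (F (x + h) - F x - h \<bullet> p) / norm h) \<midarrow>0\<rightarrow> 0"
  proof (rule Lim_null_comparison)
    show "\<forall>\<^sub>F h in at 0. norm (norm (F (x + h) - F x - h \<bullet> p) / norm h) \<le> C * norm h"
      using assms by (intro always_eventually) 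
        (auto simp: inner_commute divide_le_eq power2_eq_square mult.assoc)
    show "(\<lambda>h. C * norm h) \<midarrow>0\<rightarrow> 0" by (auto intro!: tendsto_eq_intros)
  qed
qed

lemma GDERIV_unique: "GDERIV F x :> p \<Longrightarrow> GDERIV F x :> q \<Longrightarrow> p = q"
  unfolding gderiv_def
  by (drule (1) has_derivative_unique) (metis inner_commute vector_eq_rdot ext)

lemma gradient_eqI: "GDERIV F x :> p \<Longrightarrow> gradient F x = p"
  unfolding gradient_def by (blast intro: GDERIV_unique the_equality)

text \<open>Gives the \<open>THE\<close> in \<open>gradient\<close> its meaning: in finite dimension
  the values of the derivative on the basis are the coordinates of a representing vector.\<close>

lemma GDERIV_gradient:
  fixes F :: "'a::euclidean_space \<Rightarrow> real"
  assumes "F differentiable (at x)"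
  shows "GDERIV F x :> gradient F x"
proof -
  obtain F' where F': "(F has_derivative F') (at x)" using assms by (auto simp: differentiable_def)
  interpret bounded_linear F' using F' by (rule has_derivative_bounded_linear)
  have "F' h = h \<bullet> (\<Sum>b\<in>Basis. F' b *\<^sub>R b)" for h
  proof -
    have "F' h = F' (\<Sum>b\<in>Basis. (h \<bullet> b) *\<^sub>R b)" by (simp add: euclidean_representation)
    also have "\<dots> = (\<Sum>b\<in>Basis. (h \<bullet> b) * F' b)" by (simp add: sum scaleR)
    finally show ?thesis by (simp add: inner_sum_right mult.commute)
  qed
  then have "F' = (\<lambda>h. h \<bullet> (\<Sum>b\<in>Basis. F' b *\<^sub>R b))" by (rule ext)
  with F' have "GDERIV F x :> (\<Sum>b\<in>Basis. F' b *\<^sub>R b)" by (simp add: gderiv_def)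
  then show ?thesis using gradient_eqI by metis
qed

text \<open>Convexity bounds the difference quotients along the segment by \<open>F z - F x\<close>;
  the one-sided limit at 0 is the directional derivative.\<close>

lemma convex_on_ge_gradient:
  fixes F :: "'a::real_inner \<Rightarrow> real"
  assumes "convex_on UNIV F" and "GDERIV F x :> p"
  shows "F x + p \<bullet> (z - x) \<le> F z"
proof -
  have "((\<lambda>t. F (x + t *\<^sub>R (z - x))) has_real_derivative (z - x) \<bullet> p) (at 0)"
  proof -
    have "((\<lambda>t. x + t *\<^sub>R (z - x)) has_derivative (\<lambda>t. t *\<^sub>R (z - x))) (at 0)"
      by (auto intro!: derivative_eq_intros)
    moreover have "(F has_derivative (\<lambda>h. h \<bullet> p)) (at (x + 0 *\<^sub>R (z - x)))"
      using assms(2) by (simp add: gderiv_def)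
    ultimately have "((\<lambda>t. F (x + t *\<^sub>R (z - x))) has_derivative (\<lambda>t. (t *\<^sub>R (z - x)) \<bullet> p)) (at 0)"
      by (rule has_derivative_compose)
    then show ?thesis by (simp add: has_field_derivative_def mult.commute[of _ "(z - x) \<bullet> p"])
  qed
  then have "((\<lambda>t. (F (x + t *\<^sub>R (z - x)) - F x) / t) \<longlongrightarrow> (z - x) \<bullet> p) (at 0)"
    by (simp add: DERIV_def)
  then have "((\<lambda>t. (F (x + t *\<^sub>R (z - x)) - F x) / t) \<longlongrightarrow> (z - x) \<bullet> p) (at_right 0)"
    by (rule filterlim_mono) (auto simp: at_le)
  moreover have "\<forall>\<^sub>F t in at_right 0. (F (x + t *\<^sub>R (z - x)) - F x) / t \<le> F z - F x"
  proof (rule eventually_at_rightI[of 0 1])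
    fix t :: real assume t: "t \<in> {0<..<1}"
    have "F ((1 - t) *\<^sub>R x + t *\<^sub>R z) \<le> (1 - t) * F x + t * F z"
      using t by (intro convex_onD[OF assms(1)]) auto
    moreover have "(1 - t) *\<^sub>R x + t *\<^sub>R z = x + t *\<^sub>R (z - x)" by (simp add: algebra_simps)
    ultimately show "(F (x + t *\<^sub>R (z - x)) - F x) / t \<le> F z - F x"
      using t by (simp add: divide_le_eq) (simp add: algebra_simps)
  qed simp
  ultimately have "(z - x) \<bullet> p \<le> F z - F x" by (intro tendsto_upperbound) auto
  then show ?thesis by (simp add: inner_commute)
qed

text \<open>Midpoint convexity at \<open>x + h\<close> and \<open>x - h\<close> reflects the upper
  bound at \<open>x - h\<close> into a lower bound at \<open>x + h\<close>. Thus \<open>F\<close> is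
  squeezed between two quadratics of slope \<open>p x\<close>, which yields the derivative.\<close>

lemma midpoint_convex_quadratic_bounds:
  fixes F :: "'a::real_inner \<Rightarrow> real"
  assumes mid: "\<And>x z. 2 * F ((1/2) *\<^sub>R (x + z)) \<le> F x + F z"
    and above: "\<And>x z. F z \<le> F x + p x \<bullet> (z - x) + C * (norm (z - x))\<^sup>2"
  shows "GDERIV F x :> p x" and "F x + p x \<bullet> (z - x) \<le> F z"
proof -
  have low: "F x + p x \<bullet> h - C * (norm h)\<^sup>2 \<le> F (x + h)" for h
  proof -
    have "(1/2) *\<^sub>R ((x + h) + (x - h)) = x" by (simp add: algebra_simps flip: scaleR_add_left)
    then show ?thesis using mid[of "x + h" "x - h"] above[of "x - h" x] by simp
  qed
  show "GDERIV F x :> p x"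
    using low above[of "x + _" x] by (intro has_derivative_squeeze_quadratic[where C = C]) (auto simp: abs_le_iff algebra_simps)
  define e where "e n = (1 / 2 :: real) ^ n" for n
  have e: "e n > 0" for n by (simp add: e_def)
  \<comment> \<open>Repeated halving gives the chord inequality at dyadic points. Divided by
    \<open>e n\<close>, the quadratic error in \<open>low\<close> is still of order
    \<open>e n\<close> and vanishes in the limit.\<close>
  have dyadic: "F (x + e n *\<^sub>R (z - x)) - F x \<le> e n * (F z - F x)" for n
  proof (induction n)
    case (Suc n)
    have "(1/2) *\<^sub>R (x + (x + e n *\<^sub>R (z - x))) = x + e (Suc n) *\<^sub>R (z - x)"
      by (simp add: e_def algebra_simps flip: scaleR_add_left)
    then have "2 * F (x + e (Suc n) *\<^sub>R (z - x)) \<le> F x + F (x + e n *\<^sub>R (z - x))"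
      using mid[of x "x + e n *\<^sub>R (z - x)"] by simp
    with Suc show ?case by (simp add: e_def algebra_simps)
  qed (simp add: e_def)
  have "p x \<bullet> (z - x) - C * (norm (z - x))\<^sup>2 * e n \<le> F z - F x" for n
  proof -
    have "e n * (p x \<bullet> (z - x) - C * (norm (z - x))\<^sup>2 * e n) \<le> e n * (F z - F x)"
      using low[of "e n *\<^sub>R (z - x)"] dyadic[of n] e[of n]
      by (simp add: power_mult_distrib power2_eq_square right_diff_distrib mult_ac)
    then show ?thesis using e[of n] by simp
  qed
  moreover have "(\<lambda>n. p x \<bullet> (z - x) - C * (norm (z - x))\<^sup>2 * e n) \<longlonglongrightarrow> p x \<bullet> (z - x) - C * (norm (z - x))\<^sup>2 * 0"
    unfolding e_def by (intro tendsto_intros LIMSEQ_realpow_zero) auto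
  ultimately have "p x \<bullet> (z - x) \<le> F z - F x" by (intro LIMSEQ_le_const2) auto
  then show "F x + p x \<bullet> (z - x) \<le> F z" by simp
qed

section \<open>Gibbs measures of a convex function with minimizer \<open>m\<close>\<close>

locale gibbs =
  fixes f :: "'a::euclidean_space \<Rightarrow> real" and lam del :: real and m :: 'a
  assumes del_pos: "del > 0" and lam_pos: "lam > 0"
    and convex: "convex_on UNIV f"
    and cont: "continuous_on UNIV f"
    and min: "f m \<le> f y"
begin

definition w :: "'a \<Rightarrow> 'a \<Rightarrow> real" where
  "w x y = gauss_density (lam * del) x y * exp (- f y / del)"

abbreviation M :: "'a \<Rightarrow> real" where "M \<equiv> gibbs_mass f lam del"
abbreviation F :: "'a \<Rightarrow> real" where "F \<equiv> soft_moreau f lam del"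
abbreviation xp :: "'a \<Rightarrow> 'a" where "xp \<equiv> zprox f lam del"

definition N :: "'a \<Rightarrow> 'a measure" where
  "N x = density lborel (\<lambda>y. ennreal (w x y / M x))"

text \<open>The candidate gradient of \<open>F\<close>, scaled so that the proximal map is a step of
  length \<open>lam\<close> along \<open>- p x\<close>.\<close>

definition p :: "'a \<Rightarrow> 'a" where "p x = (1 / lam) *\<^sub>R (x - xp x)"

lemma measurable_f [measurable]: "f \<in> borel_measurable borel"
  using cont by (rule borel_measurable_continuous_onI)

lemma measurable_w [measurable]: "w x \<in> borel_measurable borel"
  unfolding w_def[abs_def] gauss_density_def by measurable

lemma w_pos: "w x y > 0"
  using del_pos lam_pos by (simp add: w_def gauss_density_def)

lemma M_eq: "M x = (\<integral>y. w x y \<partial>lborel)"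
  by (simp add: gibbs_mass_def w_def)

text \<open>The Gaussian is split as \<open>E y * E y\<close>. One factor absorbs the quadratic
  growth, \<open>exp (- u / del)\<close> absorbs the growth of \<open>f y - f m\<close>, and the
  remaining \<open>E y\<close> is an integrable majorant.\<close>

lemma integrable_w_scaleR:
  fixes \<phi> :: "'a \<Rightarrow> 'b::{banach, second_countable_topology}"
  assumes [measurable]: "\<phi> \<in> borel_measurable borel"
    and bound: "\<And>y. norm (\<phi> y) \<le> a + b * (norm (y - x))\<^sup>2 + c * (f y - f m)"
    and nonneg: "0 \<le> a" "0 \<le> b" "0 \<le> c"
  shows "integrable lborel (\<lambda>y. w x y *\<^sub>R \<phi> y)"
proof -
  define s where "s = lam * del"
  have s: "s > 0" using del_pos lam_pos by (simp add: s_def)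
  define K where "K = (2 * pi * s) powr (- real DIM('a) / 2) * exp (- f m / del)"
  have K: "K > 0" using s by (simp add: K_def)
  define E where "E y = exp (- (1 / (4 * s) * (norm (y - x))\<^sup>2))" for y
  have "norm (w x y *\<^sub>R \<phi> y) \<le> K * (a + b * (4 * s) + c * del) * E y" for y
  proof -
    define r where "r = (norm (y - x))\<^sup>2"
    define u where "u = f y - f m"
    have r: "r \<ge> 0" and u: "u \<ge> 0" using min by (auto simp: r_def u_def)
    have eu: "exp (- u / del) \<le> 1" "u * exp (- u / del) \<le> del"
      using u del_pos mult_exp_neg_le[of del u] by (auto simp: divide_le_0_iff)
    have er: "E y \<le> 1" "r * E y \<le> 4 * s"
      using s mult_exp_neg_le[of "4 * s" r] by (simp_all add: E_def r_def)
    have "exp (- r / (2 * s)) = E y * E y"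
      using s by (simp add: E_def r_def flip: exp_add)
    moreover have "exp (- f y / del) = exp (- f m / del) * exp (- u / del)"
      by (simp add: u_def diff_divide_distrib flip: exp_add)
    ultimately have w: "w x y = K * (E y * E y * exp (- u / del))"
      by (simp add: w_def gauss_density_def K_def r_def s_def)
    have E0: "E y > 0" by (simp add: E_def)
    have "E y * exp (- u / del) * (a + b * r + c * u)
        = a * (E y * exp (- u / del)) + b * ((r * E y) * exp (- u / del)) + c * ((u * exp (- u / del)) * E y)"
      by (simp add: algebra_simps)
    also have "\<dots> \<le> a * (1 * 1) + b * ((4 * s) * 1) + c * (del * 1)"
    proof -
      have "E y * exp (- u / del) \<le> 1 * 1" by (rule mult_mono) (use eu er in auto)
      moreover have "(r * E y) * exp (- u / del) \<le> (4 * s) * 1" by (rule mult_mono) (use eu er s in auto)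
      moreover have "(u * exp (- u / del)) * E y \<le> del * 1" by (rule mult_mono) (use eu er del_pos E0 in auto)
      ultimately show ?thesis using nonneg by (intro add_mono mult_left_mono)
    qed
    finally have *: "E y * exp (- u / del) * (a + b * r + c * u) \<le> a + b * (4 * s) + c * del" by simp
    have "norm (w x y *\<^sub>R \<phi> y) \<le> w x y * (a + b * r + c * u)"
      using bound[of y] w_pos[of x y] by (simp add: r_def u_def)
    also have "\<dots> = K * E y * (E y * exp (- u / del) * (a + b * r + c * u))"
      by (simp add: w mult_ac)
    also have "\<dots> \<le> K * E y * (a + b * (4 * s) + c * del)"
      using K E0 * by (intro mult_left_mono) auto
    finally show ?thesis by (simp add: mult_ac)
  qed
  moreover have "integrable lborel (\<lambda>y. K * (a + b * (4 * s) + c * del) * E y)"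
    unfolding E_def using s by (intro integrable_mult_right integrable_gaussian) simp
  ultimately show ?thesis
    by (rule_tac Bochner_Integration.integrable_bound[where f = "\<lambda>y. K * (a + b * (4 * s) + c * del) * E y"])
      (auto simp del: norm_scaleR intro!: AE_I2 order_trans[OF _ abs_ge_self])
qed

lemma integrable_w: "integrable lborel (w x)"
  using integrable_w_scaleR[of "\<lambda>_. 1 :: real" 1 0 x 0] by simp

lemma M_pos: "M x > 0"
proof -
  have "M x \<noteq> 0"
  proof
    assume "M x = 0"
    then have "AE y in lborel. w x y = 0"
      using integral_nonneg_eq_0_iff_AE[OF integrable_w, of x] w_pos by (simp add: M_eq less_imp_le)
    then have "AE y in (lborel :: 'a measure). False"
      using w_pos[of x] by (simp add: less_imp_neq[symmetric])
    then show False by (simp add: ae_filter_eq_bot_iff)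
  qed
  moreover have "M x \<ge> 0" unfolding M_eq by (intro integral_nonneg_AE AE_I2) (simp add: w_pos less_imp_le)
  ultimately show ?thesis by simp
qed

lemma density_nonneg [simp]: "0 \<le> w x y / M x"
  using w_pos[of x y] M_pos[of x] by simp

lemma sets_N [measurable_cong, simp]: "sets (N x) = sets borel"
  by (simp add: N_def)

lemma space_N [simp]: "space (N x) = UNIV"
  by (simp add: N_def)

lemma integrable_N:
  fixes \<phi> :: "'a \<Rightarrow> 'b::{banach, second_countable_topology}"
  assumes [measurable]: "\<phi> \<in> borel_measurable borel"
    and "\<And>y. norm (\<phi> y) \<le> a + b * (norm (y - x))\<^sup>2 + c * (f y - f m)"
    and "0 \<le> a" "0 \<le> b" "0 \<le> c"
  shows "integrable (N x) \<phi>"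
  unfolding N_def
proof (subst integrable_density)
  have "integrable lborel (\<lambda>y. (1 / M x) *\<^sub>R (w x y *\<^sub>R \<phi> y))"
    by (intro integrable_scaleR_right integrable_w_scaleR[OF assms])
  then show "integrable lborel (\<lambda>y. (w x y / M x) *\<^sub>R \<phi> y)" by simp
qed (auto simp del: zero_le_divide_iff)

lemma integral_N:
  fixes \<phi> :: "'a \<Rightarrow> 'b::{banach, second_countable_topology}"
  assumes [measurable]: "\<phi> \<in> borel_measurable borel"
  shows "(\<integral>y. w x y *\<^sub>R \<phi> y \<partial>lborel) = M x *\<^sub>R (\<integral>y. \<phi> y \<partial>N x)"
proof -
  have "(\<integral>y. \<phi> y \<partial>N x) = (\<integral>y. (1 / M x) *\<^sub>R (w x y *\<^sub>R \<phi> y) \<partial>lborel)"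
    unfolding N_def by (subst integral_density) (auto simp del: zero_le_divide_iff)
  also have "\<dots> = (1 / M x) *\<^sub>R (\<integral>y. w x y *\<^sub>R \<phi> y \<partial>lborel)"
    by (rule integral_scaleR_right)
  finally show ?thesis using M_pos[of x] by simp
qed

lemma integrable_w_N:
  fixes \<phi> :: "'a \<Rightarrow> real"
  assumes "integrable (N x) \<phi>"
  shows "integrable lborel (\<lambda>y. w x y * \<phi> y)"
proof -
  have [measurable]: "\<phi> \<in> borel_measurable borel" using borel_measurable_integrable[OF assms] by simp
  have "integrable lborel (\<lambda>y. (w x y / M x) *\<^sub>R \<phi> y)"
    using assms unfolding N_def
    by (subst (asm) integrable_density) (auto simp del: zero_le_divide_iff)
  then have "integrable lborel (\<lambda>y. M x * ((w x y / M x) *\<^sub>R \<phi> y))" by (rule integrable_mult_right)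
  then show ?thesis using M_pos[of x] by simp
qed

lemma prob_space_N: "prob_space (N x)"
proof
  have "emeasure (N x) (space (N x)) = (\<integral>\<^sup>+y. ennreal (w x y / M x) \<partial>lborel)"
    by (simp add: N_def emeasure_density)
  also have "\<dots> = ennreal (\<integral>y. w x y / M x \<partial>lborel)"
    by (intro nn_integral_eq_integral integrable_divide_zero integrable_w AE_I2 density_nonneg)
  also have "\<dots> = 1" using M_pos[of x] by (simp add: M_eq)
  finally show "emeasure (N x) (space (N x)) = 1" .
qed

lemma measure_N [simp]: "measure (N x) UNIV = 1"
  using prob_space.prob_space[OF prob_space_N, of x] by simp

lemma integrable_const_N [simp]: "integrable (N x) (\<lambda>_. c :: 'b::{banach, second_countable_topology})"
proof -
  interpret prob_space "N x" by (rule prob_space_N)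
  show ?thesis by simp
qed

lemma integrable_sq: "integrable (N x) (\<lambda>y. (norm (y - z))\<^sup>2)"
proof (rule integrable_N)
  fix y
  have "norm (y - z) \<le> norm (y - x) + norm (x - z)" by norm
  then have "(norm (y - z))\<^sup>2 \<le> (norm (y - x) + norm (x - z))\<^sup>2" by (intro power_mono) auto
  also have "\<dots> \<le> 2 * (norm (x - z))\<^sup>2 + 2 * (norm (y - x))\<^sup>2"
    using zero_le_power2[of "norm (y - x) - norm (x - z)"] by (simp add: power2_eq_square algebra_simps)
  finally show "norm ((norm (y - z))\<^sup>2) \<le> 2 * (norm (x - z))\<^sup>2 + 2 * (norm (y - x))\<^sup>2 + 0 * (f y - f m)"
    by simp
qed auto

lemma integrable_id_diff: "integrable (N x) (\<lambda>y. y - z)"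
proof (rule integrable_N)
  fix y
  have "norm (y - z) \<le> norm (x - z) + norm (y - x)" by norm
  also have "norm (y - x) \<le> 1 + (norm (y - x))\<^sup>2"
    using zero_le_power2[of "norm (y - x) - 1"] zero_le_power2[of "norm (y - x)"]
    unfolding power2_diff by (simp, linarith)
  finally show "norm (y - z) \<le> (norm (x - z) + 1) + 1 * (norm (y - x))\<^sup>2 + 0 * (f y - f m)" by simp
qed auto

lemma integrable_id: "integrable (N x) (\<lambda>y. y)"
  using integrable_id_diff[of x 0] by simp

lemma integrable_norm_diff: "integrable (N x) (\<lambda>y. norm (y - z))"
  by (rule integrable_norm[OF integrable_id_diff])

lemma integrable_f: "integrable (N x) f"
proof (rule integrable_N)
  fix y show "norm (f y) \<le> \<bar>f m\<bar> + 0 * (norm (y - x))\<^sup>2 + 1 * (f y - f m)"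
    using min[of y] by auto
qed auto

lemma integrable_inner_diff: "integrable (N x) (\<lambda>y. (y - u) \<bullet> (y - v))"
proof -
  have "(y - u) \<bullet> (y - v) = ((norm (y - u))\<^sup>2 + (norm (y - v))\<^sup>2 - (norm (u - v))\<^sup>2) / 2" for y
    by (simp add: power2_norm_eq_inner inner_diff_left inner_diff_right inner_commute)
  then show ?thesis
    by (simp only:) (intro integrable_divide_zero Bochner_Integration.integrable_diff
        Bochner_Integration.integrable_add integrable_sq integrable_const_N)
qed

lemma zprox_eq: "xp x = (\<integral>y. y \<partial>N x)"
  using integral_N[of "\<lambda>y. y" x] M_pos[of x] by (simp add: zprox_def w_def)

lemma integral_inner_diff: "(\<integral>y. (y - z) \<bullet> v \<partial>N x) = (xp x - z) \<bullet> v"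
  by (subst integral_inner_left) (auto simp: integrable_id_diff integrable_id zprox_eq Bochner_Integration.integral_diff)

lemma xp_eq: "xp x = x - lam *\<^sub>R p x"
  using lam_pos by (simp add: p_def)

text \<open>Compares the envelope with the log-integral of another weight. The tangent of
  \<open>exp\<close> at the mean \<open>e\<close> bounds \<open>exp (- a y)\<close> below, and only
  this tangent is integrated, so integrability of \<open>exp (- a y)\<close> itself never
  arises.\<close>

lemma jensen_soft_moreau:
  assumes a: "integrable (N x) a" and w': "integrable lborel w'"
    and le: "\<And>y. w x y * exp (- a y) \<le> w' y"
  shows "- del * ln (\<integral>y. w' y \<partial>lborel) \<le> F x + del * (\<integral>y. a y \<partial>N x)"
proof -
  define e where "e = (\<integral>y. a y \<partial>N x)"
  have meas [measurable]: "a \<in> borel_measurable borel" using borel_measurable_integrable[OF a] by simp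
  have int: "integrable (N x) (\<lambda>y. exp (- e) * (1 + e - a y))"
    by (intro integrable_mult_right Bochner_Integration.integrable_diff a integrable_const_N)
  have "M x * exp (- e) = M x * (\<integral>y. exp (- e) * (1 + e - a y) \<partial>N x)"
    using a by (simp add: e_def[symmetric])
  also have "\<dots> = (\<integral>y. w x y * (exp (- e) * (1 + e - a y)) \<partial>lborel)"
    using integral_N[of "\<lambda>y. exp (- e) * (1 + e - a y)" x] by simp
  also have "\<dots> \<le> (\<integral>y. w' y \<partial>lborel)"
  proof (rule integral_mono[OF integrable_w_N[OF int] w'])
    fix y
    have "exp (- e) * (1 + e - a y) \<le> exp (- e) * exp (e - a y)"
      using exp_ge_add_one_self[of "e - a y"] by (intro mult_left_mono) (auto simp: algebra_simps)
    also have "\<dots> = exp (- a y)" by (simp flip: exp_add)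
    finally have "w x y * (exp (- e) * (1 + e - a y)) \<le> w x y * exp (- a y)"
      using w_pos[of x y] by (intro mult_left_mono) auto
    with le[of y] show "w x y * (exp (- e) * (1 + e - a y)) \<le> w' y" by linarith
  qed
  finally have "ln (M x * exp (- e)) \<le> ln (\<integral>y. w' y \<partial>lborel)"
    using M_pos[of x] by (intro ln_mono) auto
  then have "ln (M x) - e \<le> ln (\<integral>y. w' y \<partial>lborel)" using M_pos[of x] by (simp add: ln_mult)
  then have "del * (ln (M x) - e) \<le> del * ln (\<integral>y. w' y \<partial>lborel)" using del_pos by simp
  then show ?thesis by (simp add: soft_moreau_def e_def algebra_simps)
qed

lemma soft_moreau_upper: "F z \<le> F x + p x \<bullet> (z - x) + 1 / (2 * lam) * (norm (z - x))\<^sup>2"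
proof -
  \<comment> \<open>\<open>a\<close> is the change of the Gaussian exponent when the centre moves
    from \<open>x\<close> to \<open>z\<close>. It is affine in \<open>y\<close>, so its mean depends
    only on \<open>xp x\<close>.\<close>
  define a where "a y = ((norm (z - x))\<^sup>2 + 2 * ((y - x) \<bullet> (x - z))) / (2 * (lam * del))" for y
  have int: "integrable (N x) a"
    unfolding a_def
    by (intro integrable_divide_zero Bochner_Integration.integrable_add integrable_mult_right
        integrable_inner_left integrable_const_N) (rule integrable_id_diff)
  have eq: "w z y = w x y * exp (- a y)" for y
  proof -
    have "(norm (y - z))\<^sup>2 = (norm (y - x))\<^sup>2 + ((norm (z - x))\<^sup>2 + 2 * ((y - x) \<bullet> (x - z)))"
      by (simp add: power2_norm_eq_inner inner_diff_left inner_diff_right inner_commute)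
    then have "- (norm (y - z))\<^sup>2 / (2 * (lam * del)) = - (norm (y - x))\<^sup>2 / (2 * (lam * del)) - a y"
      unfolding a_def diff_divide_distrib[symmetric] by simp
    then show ?thesis by (simp only: w_def gauss_density_def diff_conv_add_uminus exp_add mult_ac)
  qed
  have "F z \<le> F x + del * (\<integral>y. a y \<partial>N x)"
    using jensen_soft_moreau[OF int integrable_w[of z]] by (simp add: eq soft_moreau_def M_eq)
  also have "(\<integral>y. a y \<partial>N x) = ((norm (z - x))\<^sup>2 + 2 * (\<integral>y. (y - x) \<bullet> (x - z) \<partial>N x)) / (2 * (lam * del))"
    unfolding a_def by (simp add: integrable_id_diff)
  also have "(\<integral>y. (y - x) \<bullet> (x - z) \<partial>N x) = lam * (p x \<bullet> (z - x))"
    by (simp only: integral_inner_diff) (simp add: xp_eq inner_diff_right right_diff_distrib)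
  finally show ?thesis using del_pos lam_pos by (simp add: add_divide_distrib distrib_left)
qed

lemma nn_integral_w: "(\<integral>\<^sup>+y. ennreal (w x y) \<partial>lborel) = ennreal (M x)"
  unfolding M_eq by (rule nn_integral_eq_integral[OF integrable_w]) (simp add: w_pos less_imp_le)

text \<open>The weight \<open>w x y\<close> is log-concave at midpoints jointly in \<open>x\<close>
  and \<open>y\<close>, so Prekopa-Leindler makes \<open>M\<close> log-concave at midpoints.\<close>

lemma soft_moreau_midpoint: "2 * F ((1/2) *\<^sub>R (x + z)) \<le> F x + F z"
proof -
  let ?c = "(1/2) *\<^sub>R (x + z)"
  define s where "s = lam * del"
  have s: "s > 0" using del_pos lam_pos by (simp add: s_def)
  have "w x y * w z y' \<le> (w ?c ((1/2) *\<^sub>R (y + y')))\<^sup>2" for y y'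
  proof -
    let ?y = "(1/2) *\<^sub>R (y + y')"
    have "f ((1 - 1/2) *\<^sub>R y + (1/2) *\<^sub>R y') \<le> (1 - 1/2) * f y + (1/2) * f y'"
      by (intro convex_onD[OF convex]) auto
    then have f: "2 * f ?y \<le> f y + f y'" by (simp add: scaleR_add_right)
    have "2 * (norm (?y - ?c))\<^sup>2 \<le> (norm (y - x))\<^sup>2 + (norm (y' - z))\<^sup>2"
    proof -
      have "?y - ?c = (1/2) *\<^sub>R ((y - x) + (y' - z))" by (simp add: algebra_simps)
      moreover have "(norm ((y - x) + (y' - z)))\<^sup>2 \<le> 2 * (norm (y - x))\<^sup>2 + 2 * (norm (y' - z))\<^sup>2"
        using zero_le_power2[of "norm ((y - x) - (y' - z))"]
        unfolding power2_norm_eq_inner inner_add_left inner_add_right inner_diff_left[of "y - x"]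
          inner_diff_right[of _ "y - x"] inner_commute[of "y' - z" "y - x"] by linarith
      ultimately show ?thesis by (simp add: power_mult_distrib power2_eq_square)
    qed
    then have "- (norm (y - x))\<^sup>2 / (2 * s) + - (norm (y' - z))\<^sup>2 / (2 * s) \<le> 2 * (- (norm (?y - ?c))\<^sup>2 / (2 * s))"
      using s divide_right_mono[of "2 * (norm (?y - ?c))\<^sup>2" "(norm (y - x))\<^sup>2 + (norm (y' - z))\<^sup>2" "2 * s"]
      by (simp only: add_divide_distrib minus_divide_left[symmetric] times_divide_eq_right[symmetric]) argo
    moreover have "- f y / del + - f y' / del \<le> 2 * (- f ?y / del)"
      using del_pos divide_right_mono[OF f, of del] by (simp only: add_divide_distrib
          minus_divide_left[symmetric] times_divide_eq_right[symmetric]) argo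
    ultimately have "exp ((- (norm (y - x))\<^sup>2 / (2 * s) + - (norm (y' - z))\<^sup>2 / (2 * s)) + (- f y / del + - f y' / del))
        \<le> exp (2 * (- (norm (?y - ?c))\<^sup>2 / (2 * s)) + 2 * (- f ?y / del))" by simp
    then have "((2 * pi * s) powr (- real DIM('a) / 2))\<^sup>2 * exp ((- (norm (y - x))\<^sup>2 / (2 * s) + - (norm (y' - z))\<^sup>2 / (2 * s)) + (- f y / del + - f y' / del))
        \<le> ((2 * pi * s) powr (- real DIM('a) / 2))\<^sup>2 * exp (2 * (- (norm (?y - ?c))\<^sup>2 / (2 * s)) + 2 * (- f ?y / del))"
      by (rule mult_left_mono) simp
    then show ?thesis
      unfolding w_def gauss_density_def s_def[symmetric]
      by (simp only: exp_add exp_double power_mult_distrib power2_eq_square mult_ac)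
  qed
  then have "ennreal (w x y) * ennreal (w z y') \<le> (ennreal (w ?c ((1/2) *\<^sub>R (y + y'))))\<^sup>2" for y y'
    using w_pos by (simp add: ennreal_power less_imp_le flip: ennreal_mult)
  then have "ennreal (M x) * ennreal (M z) \<le> (ennreal (M ?c))\<^sup>2"
    using prekopa_leindler[of "\<lambda>y. ennreal (w x y)" "\<lambda>y. ennreal (w z y)" "\<lambda>y. ennreal (w ?c y)"]
    by (simp add: nn_integral_w)
  then have "M x * M z \<le> (M ?c)\<^sup>2"
    using M_pos by (simp add: ennreal_power less_imp_le flip: ennreal_mult)
  then have "ln (M x * M z) \<le> ln ((M ?c)\<^sup>2)" using M_pos by (intro ln_mono) auto
  then have "ln (M x) + ln (M z) \<le> 2 * ln (M ?c)" using M_pos[of x] M_pos[of z] M_pos[of ?c] by (simp add: ln_mult ln_realpow)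
  then have "del * (ln (M x) + ln (M z)) \<le> del * (2 * ln (M ?c))" using del_pos by simp
  then show ?thesis by (simp add: soft_moreau_def algebra_simps)
qed

lemmas GDERIV_soft_moreau = midpoint_convex_quadratic_bounds(1)[of F p, OF soft_moreau_midpoint soft_moreau_upper]
lemmas soft_moreau_lower = midpoint_convex_quadratic_bounds(2)[of F p, OF soft_moreau_midpoint soft_moreau_upper]

lemma gradient_soft_moreau: "gradient F x = p x"
  by (rule gradient_eqI[OF GDERIV_soft_moreau])

end

section \<open>Moments of the Gibbs measure\<close>

lemma integral_lborel_affine:
  fixes g :: "'a::euclidean_space \<Rightarrow> real"
  assumes t: "t > 0" and g: "integrable lborel g"
  shows "integrable lborel (\<lambda>y. g (z + t *\<^sub>R y))"
    and "(\<integral>y. g y \<partial>lborel) = t ^ DIM('a) * (\<integral>y. g (z + t *\<^sub>R y) \<partial>lborel)"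
proof -
  have [measurable]: "g \<in> borel_measurable borel" using borel_measurable_integrable[OF g] by simp
  have affine: "lborel = density (distr lborel borel (\<lambda>y. z + t *\<^sub>R y)) (\<lambda>_. ennreal (t ^ DIM('a)))"
    using lborel_affine[of t z] t by simp
  have "integrable (density (distr lborel borel (\<lambda>y. z + t *\<^sub>R y)) (\<lambda>_. ennreal (t ^ DIM('a)))) g"
    using g by (subst affine[symmetric])
  then have "integrable lborel (\<lambda>y. t ^ DIM('a) * g (z + t *\<^sub>R y))"
    using t by (simp add: integrable_density integrable_distr_eq)
  then show "integrable lborel (\<lambda>y. g (z + t *\<^sub>R y))" using t by simp
  show "(\<integral>y. g y \<partial>lborel) = t ^ DIM('a) * (\<integral>y. g (z + t *\<^sub>R y) \<partial>lborel)"
    using t by (subst affine) (simp add: integral_density integral_distr)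
qed

context gibbs
begin

text \<open>The substitution \<open>v\<close> has Jacobian \<open>t ^ DIM('a)\<close> and preserves
  the total mass \<open>M x\<close>. \<open>Q\<close> bounds the first-order gain in the exponent
  and \<open>R\<close> is the quadratic correction.\<close>

lemma virial_scaled:
  fixes z x :: 'a
  defines "Q \<equiv> \<lambda>y. (f y - f z) / del + (y - z) \<bullet> (y - x) / (lam * del)"
    and "R \<equiv> \<lambda>y. (norm (y - z))\<^sup>2 / (2 * (lam * del))"
  assumes t: "0 < t" "t < 1"
  shows "t ^ DIM('a) * (\<integral>y. Q y \<partial>N x) \<le> real DIM('a) + (1 - t) * t ^ DIM('a) * (\<integral>y. R y \<partial>N x)"
proof -
  have Q: "integrable (N x) Q" unfolding Q_def
    by (intro Bochner_Integration.integrable_add integrable_divide_zero Bochner_Integration.integrable_diff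
        integrable_f integrable_const_N integrable_inner_diff)
  have R: "integrable (N x) R" unfolding R_def by (intro integrable_divide_zero integrable_sq)
  have [measurable]: "Q \<in> borel_measurable borel" "R \<in> borel_measurable borel"
    using borel_measurable_integrable[OF Q] borel_measurable_integrable[OF R] by simp_all
  define v where "v y = z + t *\<^sub>R (y - z)" for y
  have v_affine: "v y = (z - t *\<^sub>R z) + t *\<^sub>R y" for y by (simp add: v_def algebra_simps)
  \<comment> \<open>Convexity of \<open>f\<close> and the exact expansion of the square bound the
    logarithm of \<open>w x (v y) / w x y\<close> below; \<open>exp u \<ge> 1 + u\<close> linearizes
    the result.\<close>
  have le: "w x y * (1 + (1 - t) * (Q y - (1 - t) * R y)) \<le> w x (v y)" for y
  proof -
    have "f ((1 - t) *\<^sub>R z + t *\<^sub>R y) \<le> (1 - t) * f z + t * f y"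
      using t by (intro convex_onD[OF convex]) auto
    moreover have "(1 - t) *\<^sub>R z + t *\<^sub>R y = v y" by (simp add: v_def algebra_simps)
    ultimately have fv: "(1 - t) * (f y - f z) \<le> f y - f (v y)" by (simp add: algebra_simps)
    have "v y - x = (y - x) - (1 - t) *\<^sub>R (y - z)" by (simp add: v_def algebra_simps)
    then have "(norm (y - x))\<^sup>2 - (norm (v y - x))\<^sup>2
        = 2 * ((1 - t) * ((y - z) \<bullet> (y - x))) - (1 - t)\<^sup>2 * (norm (y - z))\<^sup>2"
      by (simp only: power2_norm_diff[of "y - x" "(1 - t) *\<^sub>R (y - z)"])
        (simp add: power_mult_distrib inner_commute[of "y - x"])
    then have "((norm (y - x))\<^sup>2 - (norm (v y - x))\<^sup>2) / (2 * (lam * del))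
        = (1 - t) * ((y - z) \<bullet> (y - x) / (lam * del)) - (1 - t) * ((1 - t) * R y)"
      by (simp add: R_def diff_divide_distrib power2_eq_square)
    moreover have "(1 - t) * ((f y - f z) / del) \<le> (f y - f (v y)) / del"
      using divide_right_mono[OF fv, of del] del_pos by simp
    ultimately have "(1 - t) * (Q y - (1 - t) * R y)
        \<le> ((norm (y - x))\<^sup>2 - (norm (v y - x))\<^sup>2) / (2 * (lam * del)) + (f y - f (v y)) / del"
      unfolding Q_def by (simp only: distrib_left right_diff_distrib[of "1 - t" "_ + _"])
    then have "1 + (1 - t) * (Q y - (1 - t) * R y)
        \<le> exp (((norm (y - x))\<^sup>2 - (norm (v y - x))\<^sup>2) / (2 * (lam * del)) + (f y - f (v y)) / del)"
      by (rule order_trans[OF add_left_mono exp_ge_add_one_self])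
    then have "w x y * (1 + (1 - t) * (Q y - (1 - t) * R y))
        \<le> w x y * exp (((norm (y - x))\<^sup>2 - (norm (v y - x))\<^sup>2) / (2 * (lam * del)) + (f y - f (v y)) / del)"
      using w_pos[of x y] by (intro mult_left_mono) auto
    also have "\<dots> = w x (v y)"
      by (simp add: w_def gauss_density_def diff_divide_distrib flip: exp_add)
    finally show ?thesis .
  qed
  have intI: "integrable (N x) (\<lambda>y. 1 + (1 - t) * (Q y - (1 - t) * R y))"
    using Q R by (intro Bochner_Integration.integrable_add Bochner_Integration.integrable_diff
        integrable_mult_right integrable_const_N)
  have "M x * (1 + (1 - t) * ((\<integral>y. Q y \<partial>N x) - (1 - t) * (\<integral>y. R y \<partial>N x)))
      = M x * (\<integral>y. 1 + (1 - t) * (Q y - (1 - t) * R y) \<partial>N x)"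
    using Q R by simp
  also have "\<dots> = (\<integral>y. w x y * (1 + (1 - t) * (Q y - (1 - t) * R y)) \<partial>lborel)"
    using integral_N[of "\<lambda>y. 1 + (1 - t) * (Q y - (1 - t) * R y)" x] by simp
  also have "\<dots> \<le> (\<integral>y. w x (v y) \<partial>lborel)"
    unfolding v_affine
    by (rule integral_mono[OF integrable_w_N[OF intI] integral_lborel_affine(1)[OF t(1) integrable_w]])
      (use le in \<open>simp add: v_affine\<close>)
  finally have "t ^ DIM('a) * (M x * (1 + (1 - t) * ((\<integral>y. Q y \<partial>N x) - (1 - t) * (\<integral>y. R y \<partial>N x))))
      \<le> t ^ DIM('a) * (\<integral>y. w x (v y) \<partial>lborel)"
    using t by (intro mult_left_mono) auto
  also have "\<dots> = M x"
    unfolding M_eq v_affine by (rule integral_lborel_affine(2)[OF t(1) integrable_w, symmetric])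
  finally have "M x * (t ^ DIM('a) * (1 + (1 - t) * ((\<integral>y. Q y \<partial>N x) - (1 - t) * (\<integral>y. R y \<partial>N x)))) \<le> M x * 1"
    by (simp add: mult_ac)
  then have "t ^ DIM('a) * (1 + (1 - t) * ((\<integral>y. Q y \<partial>N x) - (1 - t) * (\<integral>y. R y \<partial>N x))) \<le> 1"
    using M_pos[of x] by (simp only: mult_le_cancel_left_pos)
  \<comment> \<open>Bernoulli bounds the loss of volume \<open>1 - t ^ DIM('a)\<close> by
    \<open>(1 - t) * DIM('a)\<close>; dividing by \<open>1 - t\<close> produces the dimension as
    constant.\<close>
  moreover have "1 + real DIM('a) * (t - 1) \<le> t ^ DIM('a)"
    using Bernoulli_inequality[of "t - 1" "DIM('a)"] t by simp
  ultimately have "(1 - t) * (t ^ DIM('a) * ((\<integral>y. Q y \<partial>N x) - (1 - t) * (\<integral>y. R y \<partial>N x)))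
      \<le> (1 - t) * real DIM('a)"
    by (simp add: algebra_simps)
  then have "t ^ DIM('a) * ((\<integral>y. Q y \<partial>N x) - (1 - t) * (\<integral>y. R y \<partial>N x)) \<le> real DIM('a)"
    using t by simp
  then show ?thesis by (simp add: algebra_simps)
qed

text \<open>As \<open>t\<close> tends to 1 from the left in \<open>virial_scaled\<close>, the
  correction term disappears.\<close>

lemma virial:
  "(\<integral>y. f y \<partial>N x) - f z + (\<integral>y. (y - z) \<bullet> (y - x) \<partial>N x) / lam \<le> real DIM('a) * del"
proof -
  define q where "q = (\<integral>y. (f y - f z) / del + (y - z) \<bullet> (y - x) / (lam * del) \<partial>N x)"
  define r where "r = (\<integral>y. (norm (y - z))\<^sup>2 / (2 * (lam * del)) \<partial>N x)"
  have "((\<lambda>t::real. t ^ DIM('a) * q) \<longlongrightarrow> 1 ^ DIM('a) * q) (at_left 1)"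
    by (intro tendsto_intros)
  moreover have "((\<lambda>t::real. real DIM('a) + (1 - t) * t ^ DIM('a) * r)
      \<longlongrightarrow> real DIM('a) + (1 - 1) * 1 ^ DIM('a) * r) (at_left 1)"
    by (intro tendsto_intros)
  moreover have "\<forall>\<^sub>F t in at_left (1::real). t ^ DIM('a) * q \<le> real DIM('a) + (1 - t) * t ^ DIM('a) * r"
    unfolding q_def r_def by (rule eventually_at_leftI[of 0]) (rule virial_scaled, auto)
  ultimately have "1 ^ DIM('a) * q \<le> real DIM('a) + (1 - 1) * 1 ^ DIM('a) * r"
    by (intro tendsto_le[OF trivial_limit_at_left_real])
  then have "del * q \<le> real DIM('a) * del" using del_pos by simp
  moreover have "q = ((\<integral>y. f y \<partial>N x) - f z) / del + (\<integral>y. (y - z) \<bullet> (y - x) \<partial>N x) / (lam * del)"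
    unfolding q_def by (simp add: integrable_f integrable_inner_diff)
  ultimately show ?thesis using del_pos by (simp add: distrib_left)
qed

text \<open>If the mean point lay outside the closed convex epigraph, a hyperplane would separate it
  strictly; integrating that inequality over the points \<open>(y, f y)\<close> of the graph
  contradicts this.\<close>

lemma jensen: "f (xp x) \<le> (\<integral>y. f y \<partial>N x)"
proof (rule ccontr)
  assume less: "\<not> ?thesis"
  have "closed (epigraph UNIV f)"
  proof -
    have "epigraph UNIV f = {q. f (fst q) \<le> snd q}" by (auto simp: epigraph_def)
    moreover have "continuous_on UNIV (\<lambda>q::'a \<times> real. f (fst q))"
      by (rule continuous_on_compose2[OF cont]) (auto intro: continuous_intros)
    ultimately show ?thesis by (auto intro!: closed_Collect_le continuous_intros)
  qed
  moreover have "convex (epigraph UNIV f)" using convex by (simp add: convex_epigraph)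
  moreover have "(xp x, \<integral>y. f y \<partial>N x) \<notin> epigraph UNIV f" using less by (simp add: epigraph_def)
  ultimately obtain a :: "'a \<times> real" and b where ab: "a \<bullet> (xp x, \<integral>y. f y \<partial>N x) < b" "\<forall>q\<in>epigraph UNIV f. b < a \<bullet> q"
    using separating_hyperplane_closed_point[of "epigraph UNIV f"] by blast
  have int: "integrable (N x) (\<lambda>y. y \<bullet> fst a + snd a * f y)"
    by (intro Bochner_Integration.integrable_add integrable_inner_left integrable_mult_right integrable_id integrable_f)
  have "b = (\<integral>y. b \<partial>N x)" by simp
  also have "\<dots> \<le> (\<integral>y. y \<bullet> fst a + snd a * f y \<partial>N x)"
  proof (rule integral_mono[OF integrable_const_N int])
    fix y
    have "(y, f y) \<in> epigraph UNIV f" by (simp add: epigraph_def)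
    then show "b \<le> y \<bullet> fst a + snd a * f y" using ab(2) by (auto simp: inner_prod_def inner_commute less_imp_le)
  qed
  also have "\<dots> = a \<bullet> (xp x, \<integral>y. f y \<partial>N x)"
    by (simp add: integrable_id integrable_f zprox_eq inner_prod_def inner_commute)
  finally show False using ab(1) by simp
qed

text \<open>Expansion around the mean: the term linear in \<open>y - xp x\<close> integrates to
  zero.\<close>

lemma integral_inner_expand:
  "(\<integral>y. (y - z) \<bullet> (y - x) \<partial>N x) = (\<integral>y. (norm (y - xp x))\<^sup>2 \<partial>N x) + (xp x - z) \<bullet> (xp x - x)"
proof -
  define b c where "b = xp x - z" and "c = xp x - x"
  have expand: "(a + b) \<bullet> (a + c) = (norm a)\<^sup>2 + (a \<bullet> (c + b) + b \<bullet> c)" for a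
    by (simp add: inner_add_left inner_add_right power2_norm_eq_inner inner_commute[of b a])
  have "(y - z) \<bullet> (y - x) = (norm (y - xp x))\<^sup>2 + ((y - xp x) \<bullet> (c + b) + b \<bullet> c)" for y
    using expand[of "y - xp x"] by (simp add: b_def c_def)
  then have "(\<integral>y. (y - z) \<bullet> (y - x) \<partial>N x)
      = (\<integral>y. (norm (y - xp x))\<^sup>2 + ((y - xp x) \<bullet> (c + b) + b \<bullet> c) \<partial>N x)"
    by (simp only:)
  also have "\<dots> = (\<integral>y. (norm (y - xp x))\<^sup>2 \<partial>N x) + ((\<integral>y. (y - xp x) \<bullet> (c + b) \<partial>N x) + b \<bullet> c)"
  proof -
    have "(\<integral>y. (norm (y - xp x))\<^sup>2 + (g y + d) \<partial>N x) = (\<integral>y. (norm (y - xp x))\<^sup>2 \<partial>N x) + ((\<integral>y. g y \<partial>N x) + d)"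
      if "integrable (N x) g" for g :: "'a \<Rightarrow> real" and d
      using that by (simp add: integrable_sq)
    then show ?thesis by (blast intro: integrable_inner_left integrable_id_diff)
  qed
  finally show ?thesis by (simp only: integral_inner_diff) (simp add: b_def c_def)
qed

text \<open>With \<open>z = xp x\<close> the product of mean displacements vanishes, and Jensen
  makes the difference of values nonnegative, so \<open>virial\<close> leaves only the
  variance.\<close>

lemma variance_bound: "(\<integral>y. (norm (y - xp x))\<^sup>2 \<partial>N x) \<le> real DIM('a) * lam * del"
proof -
  have "(\<integral>y. (norm (y - xp x))\<^sup>2 \<partial>N x) / lam \<le> real DIM('a) * del"
    using virial[of x "xp x"] jensen[of x] by (simp add: integral_inner_expand)
  then show ?thesis using lam_pos by (simp add: field_simps)
qed

text \<open>In \<open>virial\<close> the variance is dropped and Jensen replaces the mean of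
  \<open>f\<close>; Cauchy-Schwarz treats the rest, because \<open>xp x - x\<close> is
  \<open>- lam *\<^sub>R p x\<close>.\<close>

lemma objective_gap:
  "f (xp x) - f z \<le> norm (p x) * norm (xp x - z) + real DIM('a) * del"
proof -
  have "0 \<le> (\<integral>y. (norm (y - xp x))\<^sup>2 \<partial>N x)" by (intro integral_nonneg_AE AE_I2) simp
  then have "((xp x - z) \<bullet> (xp x - x)) / lam \<le> (\<integral>y. (y - z) \<bullet> (y - x) \<partial>N x) / lam"
    using lam_pos by (intro divide_right_mono) (auto simp: integral_inner_expand)
  moreover have "((xp x - z) \<bullet> (xp x - x)) / lam = - ((xp x - z) \<bullet> p x)"
    using lam_pos by (simp add: xp_eq)
  moreover have "(xp x - z) \<bullet> p x \<le> norm (xp x - z) * norm (p x)" by (rule norm_cauchy_schwarz)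
  ultimately show ?thesis using virial[of x z] jensen[of x] by (simp add: mult.commute)
qed

text \<open>The triangle inequality passes through the mean. For the deviation,
  \<open>r \<le> (r\<^sup>2 / \<sigma> + \<sigma>) / 2\<close> reduces to the variance; with
  \<open>\<sigma>\<close> the root of the variance bound, both halves balance.\<close>

lemma expected_distance: "(\<integral>y. norm (y - x) \<partial>N x) \<le> lam * norm (p x) + sqrt (real DIM('a) * lam * del)"
proof -
  define \<sigma> where "\<sigma> = sqrt (real DIM('a) * lam * del)"
  have pos: "real DIM('a) * lam * del > 0" using del_pos lam_pos by simp
  then have \<sigma>: "\<sigma> > 0" "\<sigma>\<^sup>2 = real DIM('a) * lam * del" unfolding \<sigma>_def by simp_all
  have "(\<integral>y. norm (y - x) \<partial>N x) \<le> (\<integral>y. lam * norm (p x) + ((norm (y - xp x))\<^sup>2 / \<sigma> + \<sigma>) / 2 \<partial>N x)"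
  proof (rule integral_mono)
    fix y
    have "norm (y - x) \<le> norm (y - xp x) + norm (xp x - x)" by norm
    also have "norm (xp x - x) = lam * norm (p x)" using lam_pos by (simp add: xp_eq)
    also have "norm (y - xp x) \<le> ((norm (y - xp x))\<^sup>2 / \<sigma> + \<sigma>) / 2"
      using \<sigma>(1) zero_le_power2[of "norm (y - xp x) - \<sigma>"] by (simp add: field_simps power2_eq_square)
    finally show "norm (y - x) \<le> lam * norm (p x) + ((norm (y - xp x))\<^sup>2 / \<sigma> + \<sigma>) / 2" by simp
  qed (intro integrable_norm_diff Bochner_Integration.integrable_add integrable_divide_zero
      integrable_sq integrable_const_N)+
  also have "\<dots> = lam * norm (p x) + ((\<integral>y. (norm (y - xp x))\<^sup>2 \<partial>N x) / \<sigma> + \<sigma>) / 2"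
    by (simp add: integrable_sq)
  also have "\<dots> \<le> lam * norm (p x) + (\<sigma>\<^sup>2 / \<sigma> + \<sigma>) / 2"
    using variance_bound[of x] \<sigma> by (intro add_left_mono divide_right_mono add_right_mono) auto
  also have "\<dots> = lam * norm (p x) + \<sigma>" by (simp add: power2_eq_square)
  finally show ?thesis by (simp add: \<sigma>_def)
qed

text \<open>\<open>F (x + h)\<close> is bounded below by its tangent and above by translating the integral by \<open>h\<close>
  and applying Jensen; comparing the terms linear in \<open>h\<close> avoids the identity \<open>\<nabla>F x = E \<nabla>f\<close>.\<close>
lemma gradient_gap:
  assumes grad: "\<And>y. GDERIV f y :> g y"
    and lip: "\<And>y z. norm (g y - g z) \<le> L * norm (y - z)" and L: "L \<ge> 0"
  shows "norm (p x - g x) \<le> L * (\<integral>y. norm (y - x) \<partial>N x)"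
proof -
  define D where "D = (\<integral>y. norm (y - x) \<partial>N x)"
  have main: "(p x - g x) \<bullet> h \<le> L * norm h * D + L * (norm h)\<^sup>2" for h
  proof -
    \<comment> \<open>An upper bound for \<open>(f (y + h) - f y) / del\<close>: the tangent at
      \<open>y + h\<close> gives the slope \<open>g (y + h)\<close>, and replacing it by
      \<open>g x\<close> costs \<open>L\<close> times at most
      \<open>norm (y - x) + norm h\<close>.\<close>
    define a where "a y = (g x \<bullet> h + L * norm h * norm (y - x) + L * (norm h)\<^sup>2) / del" for y
    have int: "integrable (N x) a"
      unfolding a_def by (intro integrable_divide_zero Bochner_Integration.integrable_add
          integrable_mult_right integrable_norm_diff integrable_const_N)
    \<comment> \<open>The translation is written with the factor 1 to fit the affine change of
      variables.\<close>
    have int': "integrable lborel (\<lambda>y. w (x + h) (h + 1 *\<^sub>R y))"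
      by (rule integral_lborel_affine(1)[OF _ integrable_w]) simp
    have le: "w x y * exp (- a y) \<le> w (x + h) (h + 1 *\<^sub>R y)" for y
    proof -
      have "f (y + h) + g (y + h) \<bullet> (y - (y + h)) \<le> f y"
        by (rule convex_on_ge_gradient[OF convex grad])
      then have "f (y + h) - f y \<le> g x \<bullet> h + (g (y + h) - g x) \<bullet> h" by (simp add: inner_diff_left)
      also have "(g (y + h) - g x) \<bullet> h \<le> norm (g (y + h) - g x) * norm h" by (rule norm_cauchy_schwarz)
      also have "\<dots> \<le> (L * norm (y + h - x)) * norm h" by (intro mult_right_mono lip) simp
      also have "\<dots> \<le> (L * (norm (y - x) + norm h)) * norm h"
      proof -
        have "norm (y + h - x) \<le> norm (y - x) + norm h" by norm
        then show ?thesis using L by (intro mult_right_mono mult_left_mono) auto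
      qed
      also have "g x \<bullet> h + (L * (norm (y - x) + norm h)) * norm h = del * a y"
        using del_pos by (simp add: a_def) (simp add: algebra_simps power2_eq_square)
      finally have "f (y + h) - f y \<le> del * a y" by simp
      then have "(f (y + h) - f y) / del \<le> a y" using del_pos by (simp add: pos_divide_le_eq mult.commute)
      then have "- f y / del - a y \<le> - f (y + h) / del" by (simp add: diff_divide_distrib)
      then have "exp (- f y / del) * exp (- a y) \<le> exp (- f (y + h) / del)" by (simp flip: exp_add)
      then have "gauss_density (lam * del) x y * (exp (- f y / del) * exp (- a y))
          \<le> gauss_density (lam * del) x y * exp (- f (y + h) / del)"
        by (rule mult_left_mono) (simp add: gauss_density_def)
      then show ?thesis by (simp add: w_def gauss_density_def add.commute mult.assoc)
    qed
    have "M (x + h) = (\<integral>y. w (x + h) (h + 1 *\<^sub>R y) \<partial>lborel)"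
      unfolding M_eq by (subst integral_lborel_affine(2)[OF _ integrable_w, of 1 _ h]) simp_all
    then have "F (x + h) \<le> F x + del * (\<integral>y. a y \<partial>N x)"
      using jensen_soft_moreau[OF int int' le] by (simp add: soft_moreau_def)
    moreover have "del * (\<integral>y. a y \<partial>N x) = g x \<bullet> h + L * norm h * D + L * (norm h)\<^sup>2"
      unfolding a_def using del_pos by (simp add: D_def integrable_norm_diff)
    moreover have "F x + p x \<bullet> (x + h - x) \<le> F (x + h)" by (rule soft_moreau_lower)
    ultimately show ?thesis by (simp add: inner_diff_left)
  qed
  define q where "q = p x - g x"
  \<comment> \<open>\<open>main\<close> is tested with \<open>e *\<^sub>R q\<close> and divided by
    \<open>e\<close>; as \<open>e\<close> tends to 0 the quadratic term drops out.\<close>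
  have lim: "norm q * norm q \<le> L * norm q * D + L * (norm q)\<^sup>2 * e" if "e > 0" for e
  proof -
    have "e * (norm q * norm q) \<le> e * (L * norm q * D + L * (norm q)\<^sup>2 * e)"
    proof -
      have "q \<bullet> (e *\<^sub>R q) = e * (norm q * norm q)"
        by (simp add: power2_norm_eq_inner[symmetric] power2_eq_square)
      moreover have "L * norm (e *\<^sub>R q) * D + L * (norm (e *\<^sub>R q))\<^sup>2 = e * (L * norm q * D + L * (norm q)\<^sup>2 * e)"
        using that by (simp add: power_mult_distrib power2_eq_square distrib_left mult_ac)
      ultimately show ?thesis using main[of "e *\<^sub>R q"] unfolding q_def[symmetric] by linarith
    qed
    then show ?thesis using that by simp
  qed
  have "((\<lambda>e. L * norm q * D + L * (norm q)\<^sup>2 * e) \<longlongrightarrow> L * norm q * D + L * (norm q)\<^sup>2 * 0) (at_right 0)"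
    by (intro tendsto_intros)
  moreover have "\<forall>\<^sub>F e in at_right 0. norm q * norm q \<le> L * norm q * D + L * (norm q)\<^sup>2 * e"
    by (rule eventually_at_rightI[of 0 1]) (use lim in auto)
  ultimately have "norm q * norm q \<le> L * norm q * D + L * (norm q)\<^sup>2 * 0"
    by (intro tendsto_lowerbound) auto
  then have "norm q * norm q \<le> norm q * (L * D)" by (simp add: mult_ac)
  moreover have "L * D \<ge> 0" unfolding D_def using L by (intro mult_nonneg_nonneg integral_nonneg_AE AE_I2) auto
  ultimately have "norm q \<le> L * D" by (cases "q = 0") auto
  then show ?thesis by (simp add: q_def D_def)
qed

section \<open>Existence of minimizers of the envelope\<close>

lemma continuous_soft_moreau: "continuous_on UNIV F"
proof -
  have "F differentiable (at x)" for x
    using GDERIV_soft_moreau[of x] unfolding gderiv_def differentiable_def by blast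
  then show ?thesis
    by (meson differentiable_imp_continuous_within continuous_at_imp_continuous_on)
qed

text \<open>When the centre escapes to infinity, the Gaussian weight at each fixed \<open>y\<close>
  tends to 0, while a multiple of the integrable \<open>exp (- f y / del)\<close> dominates.\<close>

lemma M_tendsto_0:
  assumes integr: "integrable lborel (\<lambda>y. exp (- f y / del))"
    and u: "filterlim u at_infinity sequentially"
  shows "(\<lambda>n. M (u n)) \<longlonglongrightarrow> 0"
proof -
  define s where "s = lam * del"
  have s: "s > 0" using del_pos lam_pos by (simp add: s_def)
  define C where "C = (2 * pi * s) powr (- real DIM('a) / 2)"
  have C: "C \<ge> 0" by (simp add: C_def)
  have w: "w x y = C * exp (- (norm (y - x))\<^sup>2 / (2 * s)) * exp (- f y / del)" for x y
    by (simp add: w_def gauss_density_def C_def s_def)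
  have "(\<lambda>n. \<integral>y. w (u n) y \<partial>lborel) \<longlonglongrightarrow> (\<integral>y. 0 \<partial>(lborel :: 'a measure))"
  proof (rule integral_dominated_convergence)
    show "integrable lborel (\<lambda>y. C * exp (- f y / del))" using integr by simp
    show "AE y in lborel. (\<lambda>n. w (u n) y) \<longlonglongrightarrow> 0"
    proof (rule AE_I2)
      fix y
      have "filterlim (\<lambda>n. norm (y - u n)) at_top sequentially"
      proof (rule filterlim_at_top_mono)
        show "filterlim (\<lambda>n. - norm y + norm (u n)) at_top sequentially"
          using u by (intro filterlim_tendsto_add_at_top[OF tendsto_const])
            (simp add: filterlim_at_infinity_conv_norm_at_top)
        show "\<forall>\<^sub>F n in sequentially. - norm y + norm (u n) \<le> norm (y - u n)"
        proof (intro always_eventually allI)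
          fix n
          show "- norm y + norm (u n) \<le> norm (y - u n)"
            using norm_triangle_sub[of "u n" y] by (simp add: norm_minus_commute)
        qed
      qed
      moreover have "((\<lambda>r. exp (- r\<^sup>2 / (2 * s))) \<longlongrightarrow> 0) at_top" using s by real_asymp
      ultimately have "(\<lambda>n. exp (- (norm (y - u n))\<^sup>2 / (2 * s))) \<longlonglongrightarrow> 0"
        by (rule filterlim_compose[rotated])
      then have "(\<lambda>n. C * exp (- (norm (y - u n))\<^sup>2 / (2 * s)) * exp (- f y / del)) \<longlonglongrightarrow> C * 0 * exp (- f y / del)"
        by (intro tendsto_intros)
      then show "(\<lambda>n. w (u n) y) \<longlonglongrightarrow> 0" by (simp add: w)
    qed
    show "AE y in lborel. norm (w (u n) y) \<le> C * exp (- f y / del)" for n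
      using C s by (intro AE_I2) (auto simp: w abs_mult intro!: mult_right_mono mult_left_le)
  qed measurable
  then show ?thesis by (simp add: M_eq)
qed

text \<open>The sublevel set \<open>S\<close> is compact: an unbounded sequence in it would send
  \<open>M\<close> to 0, although \<open>M\<close> is at least \<open>M 0 > 0\<close> on
  \<open>S\<close>.\<close>

lemma argmin_soft_moreau:
  assumes integr: "integrable lborel (\<lambda>y. exp (- f y / del))"
  shows "argmin_set F \<noteq> {}"
proof -
  define S where "S = {x. F x \<le> F 0}"
  have "closed S" unfolding S_def
    by (rule closed_Collect_le[OF continuous_soft_moreau continuous_on_const])
  moreover have "bounded S"
  proof (rule ccontr)
    assume "\<not> bounded S"
    then have "\<forall>n::nat. \<exists>x\<in>S. real n < norm x" unfolding bounded_iff by (meson linorder_not_le)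
    then obtain u where u: "\<And>n. u n \<in> S" "\<And>n. real n < norm (u n)" by metis
    have "filterlim (\<lambda>n. norm (u n)) at_top sequentially"
      by (rule filterlim_at_top_mono[OF filterlim_real_sequentially])
        (use u(2) in \<open>auto intro!: always_eventually less_imp_le\<close>)
    then have "(\<lambda>n. M (u n)) \<longlonglongrightarrow> 0"
      by (intro M_tendsto_0[OF integr]) (simp add: filterlim_at_infinity_conv_norm_at_top)
    moreover have "M 0 \<le> M (u n)" for n
      using u(1)[of n] del_pos M_pos by (simp add: S_def soft_moreau_def)
    ultimately have "M 0 \<le> 0" by (intro LIMSEQ_le_const) auto
    then show False using M_pos[of 0] by simp
  qed
  ultimately have "compact S" by (simp add: compact_eq_bounded_closed)
  moreover have "0 \<in> S" by (simp add: S_def)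
  ultimately obtain x where x: "x \<in> S" "\<forall>y\<in>S. F x \<le> F y"
    using continuous_attains_inf[of S F] continuous_on_subset[OF continuous_soft_moreau] by blast
  have "F x \<le> F y" for y using x by (cases "y \<in> S") (auto simp: S_def)
  then show ?thesis by (auto simp: argmin_set_def)
qed

end

section \<open>Value, gradient and rate bounds along the iteration\<close>

theorem theorem6:
  fixes f :: "'a::euclidean_space \<Rightarrow> real"
    and lam del :: real
    and x :: "nat \<Rightarrow> 'a"
  assumes del_pos: "del > 0" and lam_pos: "lam > 0"
    and convex: "convex_on UNIV f"
    and cont: "continuous_on UNIV f"
    and has_min: "argmin_set f \<noteq> {}"
    and integr: "integrable lborel (\<lambda>y. exp (- f y / del))"
    and iter: "\<And>k. x (Suc k) = zprox f lam del (x k)"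
  shows
    "(\<forall>k\<ge>1. f (x k) - (INF y. f y)
        \<le> norm (gradient (soft_moreau f lam del) (x (k - 1))) * infdist (x k) (argmin_set f)
           + real DIM('a) * del)
     \<and> (\<forall>L. L_smooth L f \<longrightarrow>
          (\<forall>k. norm (gradient f (x k))
                 \<le> (1 + lam * L) * norm (gradient (soft_moreau f lam del) (x k))
                   + L * sqrt (real DIM('a) * lam * del)
             \<and> f (x k) - (INF y. f y)
                 \<le> ((1 + lam * L) * norm (gradient (soft_moreau f lam del) (x k))
                     + L * sqrt (real DIM('a) * lam * del)) * infdist (x k) (argmin_set f)))
     \<and> (\<forall>k\<ge>1. norm (gradient (soft_moreau f lam del) (x k))
          \<le> 2 * infdist (x 0) (argmin_set (soft_moreau f lam del)) / (lam * (real k + 1)))"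
proof -
  obtain m where m: "m \<in> argmin_set f" using has_min by blast
  interpret gibbs f lam del m
    by unfold_locales (use del_pos lam_pos convex cont m in \<open>auto simp: argmin_set_def\<close>)
  have Inf: "(INF y. f y) = f z" if "z \<in> argmin_set f" for z
    using that by (intro cInf_eq_minimum) (auto simp: argmin_set_def)
  have "closed (argmin_set f)"
    unfolding argmin_set_def by (intro closed_Collect_all closed_Collect_le cont continuous_on_const)
  \<comment> \<open>A closed nonempty set in finite dimension has a nearest point, so bounds against
    a single minimizer become bounds by the distance.\<close>
  then have nearest: "\<exists>z\<in>argmin_set f. infdist y (argmin_set f) = norm (y - z)" for y
    using infdist_attains_inf[OF _ has_min] by (metis dist_norm)
  show ?thesis
    unfolding gradient_soft_moreau
  proof (intro conjI allI impI)
    fix k :: nat assume "k \<ge> 1"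
    \<comment> \<open>\<open>k \<ge> 1\<close> makes the natural subtraction genuine, so
      \<open>x k\<close> is the mean of the Gibbs measure centred at the previous iterate.\<close>
    then have xk: "x k = xp (x (k - 1))" using iter[of "k - 1"] by simp
    obtain z where z: "z \<in> argmin_set f" "infdist (x k) (argmin_set f) = norm (x k - z)"
      using nearest by blast
    show "f (x k) - (INF y. f y) \<le> norm (p (x (k - 1))) * infdist (x k) (argmin_set f) + real DIM('a) * del"
      using objective_gap[of "x (k - 1)" z] unfolding xk[symmetric] z(2) Inf[OF z(1)] .
  next
    fix L k assume smooth: "L_smooth L f"
    have grad: "GDERIV f y :> gradient f y" for y
      using smooth GDERIV_gradient by (auto simp: L_smooth_def)
    have lip: "norm (gradient f y - gradient f z) \<le> L * norm (y - z)" for y z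
      using smooth by (auto simp: L_smooth_def)
    obtain b :: 'a where "b \<in> Basis" using nonempty_Basis by blast
    \<comment> \<open>A basis vector and 0 are at distance one, so the Lipschitz bound between them
      forces the sign of \<open>L\<close>.\<close>
    then have L: "L \<ge> 0" using lip[of b 0] by (metis norm_Basis diff_zero mult.right_neutral norm_ge_zero order_trans)
    let ?B = "(1 + lam * L) * norm (p (x k)) + L * sqrt (real DIM('a) * lam * del)"
    have "norm (gradient f (x k)) \<le> norm (p (x k)) + norm (p (x k) - gradient f (x k))" by norm
    also have "norm (p (x k) - gradient f (x k)) \<le> L * (\<integral>y. norm (y - x k) \<partial>N (x k))"
      by (rule gradient_gap[OF grad lip L])
    also have "\<dots> \<le> L * (lam * norm (p (x k)) + sqrt (real DIM('a) * lam * del))"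
      by (intro mult_left_mono expected_distance L)
    finally show le: "norm (gradient f (x k)) \<le> ?B" by (simp add: algebra_simps)
    obtain z where z: "z \<in> argmin_set f" "infdist (x k) (argmin_set f) = norm (x k - z)"
      using nearest by blast
    have "f (x k) - f z \<le> gradient f (x k) \<bullet> (x k - z)"
      using convex_on_ge_gradient[OF convex grad, of "x k" z] by (simp add: inner_diff_right)
    also have "\<dots> \<le> norm (gradient f (x k)) * norm (x k - z)" by (rule norm_cauchy_schwarz)
    also have "\<dots> \<le> ?B * norm (x k - z)" by (intro mult_right_mono le) simp
    finally show "f (x k) - (INF y. f y) \<le> ?B * infdist (x k) (argmin_set f)" unfolding z(2) Inf[OF z(1)] .
  next
    fix k :: nat
    have ne: "argmin_set F \<noteq> {}" by (rule argmin_soft_moreau[OF integr])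
    have rate: "lam * (real k + 1) * norm (p (x k)) \<le> norm (x 0 - z)" if "z \<in> argmin_set F" for z
    proof (rule gradient_descent_rate[OF lam_pos soft_moreau_lower])
      show "F v \<le> F u + p u \<bullet> (v - u) + (norm (v - u))\<^sup>2 / (2 * lam)" for u v
        using soft_moreau_upper[of v u] by simp
    qed (use that in \<open>auto simp: argmin_set_def iter xp_eq\<close>)
    have "lam * (real k + 1) * norm (p (x k)) \<le> infdist (x 0) (argmin_set F)"
      unfolding infdist_notempty[OF ne] by (rule cINF_greatest[OF ne]) (simp add: rate dist_norm)
    then have "norm (p (x k)) \<le> infdist (x 0) (argmin_set F) / (lam * (real k + 1))"
      using lam_pos by (simp add: le_divide_eq mult.commute)
    \<comment> \<open>The rate obtained has constant 1; the factor 2 of the claim is slack.\<close>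
    also have "\<dots> \<le> 2 * infdist (x 0) (argmin_set F) / (lam * (real k + 1))"
      using lam_pos infdist_nonneg[of "x 0" "argmin_set F"] by (intro divide_right_mono) auto
    finally show "norm (p (x k)) \<le> 2 * infdist (x 0) (argmin_set F) / (lam * (real k + 1))" .
  qed
qed

end
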